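(* Let $\Sigma_A$ be an irreducible subshift of finite type on the alphabet $\mathcal{J}=\{0,1,\dots,M-1\}$, with associated contracting similarities $S_i(x)=r_iT_i(x)+v_i$ ($i\in\mathcal{J}$) of $\mathbb{R}^d$, such that at least one $F_A^i$ ($i\in\mathcal{J}$) contains at least two points, and let $j\in\mathcal{J}$. Then for every $\varepsilon>0$ and every $O\in\overline{\mathcal{T}_{j,A}^G}$ there exist $r\in(0,1)$ and a self-similar iterated function system (SS-IFS) $\{\widetilde S_i\}_{i=1}^m$, $\widetilde S_i(x)=\widetilde r_i\widetilde T_i(x)+\widetilde v_i$, in $\mathbb{R}^d$ that satisfies the strong separation condition, with attractor $K$, such that $K\subseteq F_A^j\subseteq F_A$, $\dim_H F_A-\varepsilon<\dim_H K$, and $\|\widetilde T_i-O\|<\varepsilon$ and $\widetilde r_i=r$ for every $i\in\{1,\dots,m\}$.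
   Context: Subshifts of finite type. Let $\mathcal{J}=\{0,1,\dots,M-1\}$ and let $A$ be an $M\times M$ matrix indexed by $\mathcal{J}\times\mathcal{J}$ with entries in $\{0,1\}$. Put $\Sigma_A=\{\alpha=(\alpha_0,\alpha_1,\dots)\in\mathcal{J}^{\mathbb{N}}:A_{\alpha_i,\alpha_{i+1}}=1\text{ for all }i=0,1,\dots\}$. $\Sigma_A$ is irreducible if for all $i,j\in\mathcal{J}$ there is a positive integer $n$ with $(A^n)_{i,j}>0$. To each $i\in\mathcal{J}$ is associated a contracting similarity $S_i(x)=r_iT_i(x)+v_i$ of $\mathbb{R}^d$ with $r_i\in(0,1)$, $T_i\in\mathbb{O}_d$ (the orthogonal group), $v_i\in\mathbb{R}^d$. For $\alpha\in\mathcal{J}^{\mathbb{N}}$ let $\Pi(\alpha)=\lim_{k\to\infty}S_{\alpha_0}\circ\cdots\circ S_{\alpha_{k-1}}(0)$. Put $F_A=\Pi(\Sigma_A)$ and $F_A^j=\Pi(\{\alpha\in\Sigma_A:\alpha_0=j\})$. The $j$-th transformation group $\mathcal{T}_{j,A}^G$ is the group generated by all $T_{\alpha_0}\circ T_{\alpha_1}\circ\cdots\circ T_{\alpha_{k-1}}$ where $k\ge1$, $(\alpha_0,\dots,\alpha_{k-1})\in\mathcal{J}^k$, $\alpha_0=j$, $A_{\alpha_i,\alpha_{i+1}}=1$ for $0\le i\le k-2$, and $A_{\alpha_{k-1},j}=1$. Self-similar systems. An SS-IFS in $\mathbb{R}^d$ is a finite collection $\{\widetilde S_i\}_{i=1}^m$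 of contracting similarities of $\mathbb{R}^d$, $\widetilde S_i(x)=\widetilde r_i\widetilde T_i(x)+\widetilde v_i$ with $0<\widetilde r_i<1$, $\widetilde T_i\in\mathbb{O}_d$, $\widetilde v_i\in\mathbb{R}^d$. Its attractor is the unique nonempty compact $K$ with $K=\bigcup_{i=1}^m\widetilde S_i(K)$; the strong separation condition (SSC) means that the sets $\widetilde S_1(K),\dots,\widetilde S_m(K)$ are pairwise disjoint. $\dim_H$ is Hausdorff dimension, $\overline{\mathcal{T}_{j,A}^G}$ is the closure in $\mathbb{O}_d$ with its usual topology, and $\|\cdot\|$ is the Euclidean operator norm. *)

theory Defs
  imports
    "Jordan_Normal_Form.Matrix"
    "HOL-Algebra.Generated_Groups"
    "HOL-Analysis.Analysis"
begin

text \<open>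
  The transition matrix of a subshift has a variable size \<open>M\<close> and is a matrix of
  Jordan_Normal_Form, where a matrix power is available; elements of \<open>O\<^sub>d\<close> are matrices of type
  \<^typ>\<open>real ^ 'd ^ 'd\<close>. The names shared by both libraries refer to HOL-Analysis below.
\<close>

hide_const (open) Matrix.mat Matrix.vec Matrix.row Matrix.transpose_mat
hide_type (open) Matrix.vec
no_notation Matrix.vec_index (infixl \<open>$\<close> 100)


section \<open>Hausdorff dimension\<close>

text \<open>The conventions are \<open>0^0 = 1\<close> for a nonempty set, whereas the empty set contributes \<open>0\<close>
  for every exponent; note that \<^term>\<open>0 powr 0 = (0::real)\<close>.\<close>

definition diam_pow :: "real \<Rightarrow> 'a::metric_space set \<Rightarrow> real" where
  "diam_pow s U = (if U = {} then 0 else if s = 0 then 1 else diameter U powr s)"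

text \<open>Boundedness is required explicitly because \<^const>\<open>diameter\<close> is unspecified on unbounded
  sets. Finite covers are included, since the \<open>U i\<close> may be empty.\<close>

definition delta_covers :: "real \<Rightarrow> 'a::metric_space set \<Rightarrow> (nat \<Rightarrow> 'a set) set" where
  "delta_covers \<delta> E =
     {U. E \<subseteq> (\<Union>i. U i) \<and> (\<forall>i. bounded (U i) \<and> diameter (U i) \<le> \<delta>)}"

definition hausdorff_premeasure :: "real \<Rightarrow> real \<Rightarrow> 'a::metric_space set \<Rightarrow> ennreal" where
  "hausdorff_premeasure s \<delta> E = (INF U\<in>delta_covers \<delta> E. \<Sum>i. ennreal (diam_pow s (U i)))"

definition hausdorff_measure :: "real \<Rightarrow> 'a::metric_space set \<Rightarrow> ennreal" where
  "hausdorff_measure s E = (SUP \<delta>\<in>{0<..}. hausdorff_premeasure s \<delta> E)"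

text \<open>A real infimum is adequate in a Euclidean space: the \<open>s\<close>-dimensional measure of every
  subset vanishes for \<open>s\<close> larger than the dimension of the space.\<close>

definition hausdorff_dim :: "'a::euclidean_space set \<Rightarrow> real" where
  "hausdorff_dim E = Inf {s. 0 \<le> s \<and> hausdorff_measure s E = 0}"


section \<open>Families of contracting similarities\<close>

definition similarity :: "real \<Rightarrow> real^'d^'d \<Rightarrow> real^'d \<Rightarrow> real^'d \<Rightarrow> real^'d" where
  "similarity r T v x = r *\<^sub>R (T *v x) + v"

definition contracting_similarities ::
    "nat set \<Rightarrow> (nat \<Rightarrow> real) \<Rightarrow> (nat \<Rightarrow> real^'d^'d) \<Rightarrow> (nat \<Rightarrow> real^'d) \<Rightarrow> bool" where
  "contracting_similarities I r T v \<longleftrightarrow> (\<forall>i\<in>I. 0 < r i \<and> r i < 1 \<and> orthogonal_matrix (T i))"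

definition ss_ifs ::
    "nat \<Rightarrow> (nat \<Rightarrow> real) \<Rightarrow> (nat \<Rightarrow> real^'d^'d) \<Rightarrow> (nat \<Rightarrow> real^'d) \<Rightarrow> bool" where
  "ss_ifs m r T v \<longleftrightarrow> 1 \<le> m \<and> contracting_similarities {1..m} r T v"

definition is_attractor :: "nat \<Rightarrow> (nat \<Rightarrow> 'a \<Rightarrow> 'a) \<Rightarrow> 'a::topological_space set \<Rightarrow> bool" where
  "is_attractor m S K \<longleftrightarrow> K \<noteq> {} \<and> compact K \<and> K = (\<Union>i\<in>{1..m}. S i ` K)"

definition strong_separation :: "nat \<Rightarrow> (nat \<Rightarrow> 'a \<Rightarrow> 'a) \<Rightarrow> 'a set \<Rightarrow> bool" where
  "strong_separation m S K \<longleftrightarrow> disjoint_family_on (\<lambda>i. S i ` K) {1..m}"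


section \<open>Subshifts of finite type\<close>

definition transition_matrix :: "nat \<Rightarrow> nat mat \<Rightarrow> bool" where
  "transition_matrix M A \<longleftrightarrow> A \<in> carrier_mat M M \<and> (\<forall>i<M. \<forall>j<M. A $$ (i, j) \<in> {0, 1})"

definition subshift :: "nat \<Rightarrow> nat mat \<Rightarrow> (nat \<Rightarrow> nat) set" where
  "subshift M A = {\<alpha>. (\<forall>i. \<alpha> i < M) \<and> (\<forall>i. A $$ (\<alpha> i, \<alpha> (Suc i)) = 1)}"

definition irreducible_subshift :: "nat \<Rightarrow> nat mat \<Rightarrow> bool" where
  "irreducible_subshift M A \<longleftrightarrow> (\<forall>i<M. \<forall>j<M. \<exists>n>0. (A ^\<^sub>m n) $$ (i, j) > 0)"

text \<open>Here \<open>foldr S [a\<^sub>0, \<dots>, a\<^sub>k] x = S a\<^sub>0 (\<dots> (S a\<^sub>k x))\<close>.\<close>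

definition coding_map :: "(nat \<Rightarrow> 'a \<Rightarrow> 'a) \<Rightarrow> (nat \<Rightarrow> nat) \<Rightarrow> 'a::real_normed_vector" where
  "coding_map S \<alpha> = lim (\<lambda>k. foldr S (map \<alpha> [0..<k]) 0)"

definition subshift_set ::
    "nat \<Rightarrow> nat mat \<Rightarrow> (nat \<Rightarrow> 'a \<Rightarrow> 'a) \<Rightarrow> 'a::real_normed_vector set" where
  "subshift_set M A S = coding_map S ` subshift M A"

definition subshift_cylinder_set ::
    "nat \<Rightarrow> nat mat \<Rightarrow> (nat \<Rightarrow> 'a \<Rightarrow> 'a) \<Rightarrow> nat \<Rightarrow> 'a::real_normed_vector set" where
  "subshift_cylinder_set M A S j = coding_map S ` {\<alpha> \<in> subshift M A. \<alpha> 0 = j}"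


section \<open>Transformation groups\<close>

definition orthogonal_group :: "(real^'d^'d) monoid" where
  "orthogonal_group = \<lparr>carrier = {Q. orthogonal_matrix Q}, mult = (**), one = mat 1\<rparr>"

lemma group_orthogonal_group: "group orthogonal_group"
proof (rule groupI)
  fix Q :: "real^'d^'d"
  assume "Q \<in> carrier orthogonal_group"
  then show "\<exists>P\<in>carrier orthogonal_group. P \<otimes>\<^bsub>orthogonal_group\<^esub> Q = \<one>\<^bsub>orthogonal_group\<^esub>"
    by (intro bexI[of _ "transpose Q"])
       (auto simp: orthogonal_group_def orthogonal_matrix_def transpose_transpose)
qed (auto simp: orthogonal_group_def orthogonal_matrix_mul orthogonal_matrix_id
       matrix_mul_assoc)

text \<open>The words \<open>a\<^sub>0 \<dots> a\<^sub>k\<close> with \<open>a\<^sub>0 = j\<close> for which \<open>a\<^sub>0 \<dots> a\<^sub>k j\<close> is admissible.\<close>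

definition return_words :: "nat \<Rightarrow> nat mat \<Rightarrow> nat \<Rightarrow> nat list set" where
  "return_words M A j =
     {w. w \<noteq> [] \<and> set w \<subseteq> {..<M} \<and> hd w = j \<and>
         (\<forall>i. Suc i < length w \<longrightarrow> A $$ (w ! i, w ! Suc i) = 1) \<and> A $$ (last w, j) = 1}"

definition word_product :: "(nat \<Rightarrow> real^'d^'d) \<Rightarrow> nat list \<Rightarrow> real^'d^'d" where
  "word_product T w = foldr (\<lambda>i P. T i ** P) w (mat 1)"

definition transformation_group ::
    "nat \<Rightarrow> nat mat \<Rightarrow> (nat \<Rightarrow> real^'d^'d) \<Rightarrow> nat \<Rightarrow> (real^'d^'d) set" where
  "transformation_group M A T j = generate orthogonal_group (word_product T ` return_words M A j)"

definition orthogonal_closure :: "(real^'d^'d) set \<Rightarrow> (real^'d^'d) set" where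
  "orthogonal_closure G = top_of_set (carrier orthogonal_group) closure_of G"

definition op_norm :: "real^'d^'d \<Rightarrow> real" where
  "op_norm B = onorm ((*v) B)"

end

theory Submission
  imports Defs "HOL-Real_Asymp.Real_Asymp"
begin

text \<open>
  Write \<open>F i\<close> for the points coded by admissible sequences that start with \<open>i\<close>. A return word
  \<open>w\<close> at \<open>j\<close>, that is, an admissible word with first letter \<open>j\<close> that may be followed by \<open>j\<close>,
  composes to a similarity that maps \<open>F j\<close> into itself. Hence a finite set \<open>U\<close> of return words of a
  common ratio \<open>\<rho>\<close>, whose images of \<open>F j\<close> are pairwise disjoint, has an attractor \<open>K \<subseteq> F j\<close> with
  strong separation, and \<open>dim K \<ge> \<tau>\<close> as soon as \<open>card U * \<rho> powr \<tau> \<ge> 1\<close>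
  (\<open>self_similar_subset_of_words\<close>). What has to be found is such a \<open>U\<close> for \<open>\<tau>\<close> just below the
  dimension \<open>D\<close> of the whole set, with rotations near \<open>Q\<close> (\<open>homogeneous_return_words\<close>).

  Fix \<open>\<tau> < t < D\<close>. The Hausdorff dimension is at most the lower box dimension, and each \<open>F i\<close> has a
  similar copy in \<open>F j\<close>; therefore, for all small \<open>\<delta>\<close>, a maximal \<open>\<delta>\<close>-separated subset of \<open>F j\<close> has
  more than a constant times \<open>\<delta> powr - t\<close> points (\<open>covering_number_F_ge\<close>). Near each of these
  points lies the piece of a return word whose ratio is comparable to \<open>\<delta>\<close> (\<open>local_return_words\<close>),
  and separation of the points makes these pieces disjoint.

  Two applications of the pigeonhole principle make the words homogeneous, at a cost that is
  negligible against \<open>\<delta> powr (\<tau> - t)\<close>. The ratio of a word depends only on how often each of the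
  \<open>M\<close> letters occurs, and the words have length \<open>O(ln (1/\<delta>))\<close>, so that there are only polynomially
  many ratios in \<open>ln (1/\<delta>)\<close> (\<open>card_ratios_le\<close>). As to the rotations, the closure of a semigroup of
  orthogonal matrices is a group, because the powers of an orthogonal matrix come back close to the
  identity. By total boundedness a finite set of return words \<open>w\<close> therefore suffices to bring
  the rotation of \<open>w @ u\<close> close to \<open>Q\<close> for every return word \<open>u\<close> (\<open>finite_correcting_words\<close>); prefixing
  a fixed \<open>w\<close> preserves disjointness and equality of ratios.

  The lower bound for \<open>dim K\<close> is obtained without a measure, by induction on the size of a finite
  cover (\<open>self_similar_cover_sum_ge\<close>).
\<close>

section \<open>Bounds for the Hausdorff dimension\<close>

lemma hausdorff_premeasure_le_finite_cover:
  fixes E :: "'a::metric_space set"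
  assumes "finite \<U>" "E \<subseteq> \<Union>\<U>" "\<And>U. U \<in> \<U> \<Longrightarrow> bounded U \<and> diameter U \<le> d"
    and "d \<le> \<delta>" "0 < \<delta>" "0 < s"
  shows "hausdorff_premeasure s \<delta> E \<le> ennreal (real (card \<U>) * d powr s)"
proof -
  let ?n = "card \<U>"
  obtain h where h: "bij_betw h {..<?n} \<U>"
    using ex_bij_betw_nat_finite[OF assms(1)] by (auto simp: atLeast0LessThan)
  define U where "U i = (if i < ?n then h i else {})" for i
  have hU: "h i \<in> \<U>" if "i < ?n" for i
    using h that by (auto simp: bij_betw_def)
  have "\<Union>\<U> \<subseteq> (\<Union>i. U i)"
  proof
    fix x assume "x \<in> \<Union>\<U>"
    then obtain W where "W \<in> \<U>" "x \<in> W" by blast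
    moreover from this obtain i where "i < ?n" "h i = W"
      using bij_betw_imp_surj_on[OF h] by (metis imageE lessThan_iff)
    ultimately have "x \<in> U i" by (simp add: U_def)
    then show "x \<in> (\<Union>i. U i)" by blast
  qed
  then have "U \<in> delta_covers \<delta> E"
    using assms hU by (force simp: delta_covers_def U_def)
  then have "hausdorff_premeasure s \<delta> E \<le> (\<Sum>i. ennreal (diam_pow s (U i)))"
    unfolding hausdorff_premeasure_def by (rule INF_lower)
  also have "\<dots> = (\<Sum>i<?n. ennreal (diam_pow s (U i)))"
    by (rule suminf_finite) (auto simp: U_def diam_pow_def)
  also have "\<dots> \<le> (\<Sum>i<?n. ennreal (d powr s))"
  proof (intro sum_mono ennreal_leI)
    fix i assume "i \<in> {..<?n}"
    then have "bounded (h i)" "diameter (h i) \<le> d"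
      using hU assms(3) by auto
    then show "diam_pow s (U i) \<le> d powr s"
      using assms(6) diameter_ge_0[of "h i"] by (auto simp: diam_pow_def U_def intro!: powr_mono2)
  qed
  also have "\<dots> = ennreal (real ?n * d powr s)"
    by (simp add: ennreal_mult ennreal_of_nat_eq_real_of_nat)
  finally show ?thesis .
qed

lemma hausdorff_measure_eq_0I:
  fixes E :: "'a::metric_space set"
  assumes "0 < s"
    and "\<And>e. 0 < e \<Longrightarrow> \<exists>\<U> d. finite \<U> \<and> E \<subseteq> \<Union>\<U> \<and> (\<forall>U\<in>\<U>. bounded U \<and> diameter U \<le> d) \<and>
           d \<le> e \<and> real (card \<U>) * d powr s \<le> e"
  shows "hausdorff_measure s E = 0"
proof -
  have "hausdorff_premeasure s \<delta> E \<le> 0" if "0 < \<delta>" for \<delta>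
  proof (rule ennreal_le_epsilon)
    fix e :: real assume "0 < e"
    with that obtain \<U> d where *: "finite \<U>" "E \<subseteq> \<Union>\<U>" "\<forall>U\<in>\<U>. bounded U \<and> diameter U \<le> d"
      "d \<le> min e \<delta>" "real (card \<U>) * d powr s \<le> min e \<delta>"
      using assms(2)[of "min e \<delta>"] by (metis min_less_iff_conj)
    have "hausdorff_premeasure s \<delta> E \<le> ennreal (real (card \<U>) * d powr s)"
      by (rule hausdorff_premeasure_le_finite_cover) (use * that assms(1) in auto)
    also have "\<dots> \<le> ennreal e"
      using * by (intro ennreal_leI) auto
    finally show "hausdorff_premeasure s \<delta> E \<le> 0 + ennreal e" by simp
  qed
  then have "hausdorff_measure s E \<le> 0"
    unfolding hausdorff_measure_def by (intro SUP_least) auto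
  then show ?thesis by simp
qed

lemma hausdorff_dim_le:
  assumes "0 \<le> s" "hausdorff_measure s E = 0"
  shows "hausdorff_dim E \<le> s"
  unfolding hausdorff_dim_def
  by (rule cInf_lower) (use assms in \<open>auto intro!: bdd_belowI[of _ 0]\<close>)

lemma hausdorff_dim_ge:
  assumes "0 \<le> s\<^sub>0" "hausdorff_measure s\<^sub>0 E = 0"
    and "\<And>s. 0 \<le> s \<Longrightarrow> s < t \<Longrightarrow> hausdorff_measure s E \<noteq> 0"
  shows "t \<le> hausdorff_dim E"
  unfolding hausdorff_dim_def
  by (rule cInf_greatest) (use assms in \<open>auto intro: leI\<close>)

lemma hausdorff_measure_0_neq_0:
  fixes E :: "'a::metric_space set"
  assumes "E \<noteq> {}"
  shows "hausdorff_measure 0 E \<noteq> 0"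
proof -
  have "1 \<le> (\<Sum>i. ennreal (diam_pow 0 (U i)))" if "U \<in> delta_covers 1 E" for U
  proof -
    obtain x where "x \<in> E" using assms by auto
    moreover have "E \<subseteq> (\<Union>i. U i)"
      using that by (simp add: delta_covers_def)
    ultimately obtain i where "x \<in> U i" by blast
    then have "U i \<noteq> {}" by blast
    then have "1 = (\<Sum>k\<in>{i}. ennreal (diam_pow 0 (U k)))"
      by (simp add: diam_pow_def)
    also have "\<dots> \<le> (\<Sum>i. ennreal (diam_pow 0 (U i)))"
      by (rule sum_le_suminf) auto
    finally show ?thesis .
  qed
  then have "1 \<le> hausdorff_premeasure 0 1 E"
    unfolding hausdorff_premeasure_def by (rule INF_greatest)
  also have "\<dots> \<le> hausdorff_measure 0 E"
    unfolding hausdorff_measure_def by (rule SUP_upper) simp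
  finally show ?thesis by auto
qed

text \<open>A set in a cover can be enlarged to an open set at an arbitrarily small cost, which lets
  compactness act on arbitrary countable covers.\<close>

lemma diameter_powr_thicken:
  fixes U :: "'a::real_normed_vector set"
  assumes "bounded U" "0 < s" "0 < e"
  obtains V where "open V" "bounded V" "U \<subseteq> V" "diameter V powr s \<le> diam_pow s U + e"
proof (cases "U = {}")
  case True
  show ?thesis by (rule that[of "{}"]) (use True assms in \<open>auto simp: diam_pow_def\<close>)
next
  case False
  have "((\<lambda>\<eta>. (diameter U + 2 * \<eta>) powr s) \<longlongrightarrow> (diameter U + 2 * 0) powr s) (at_right 0)"
    using assms diameter_ge_0[OF assms(1)]
    by (intro tendsto_powr2 tendsto_add tendsto_mult tendsto_const tendsto_ident_at)
       (auto intro!: eventually_at_rightI[of 0 1])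
  then have "\<forall>\<^sub>F \<eta> in at_right 0. (diameter U + 2 * \<eta>) powr s < diameter U powr s + e"
    by (rule order_tendstoD) (use assms in auto)
  moreover have "\<forall>\<^sub>F \<eta> in at_right 0. (0::real) < \<eta>"
    by (rule eventually_at_right_less)
  ultimately have "\<forall>\<^sub>F \<eta> in at_right 0. 0 < \<eta> \<and> (diameter U + 2 * \<eta>) powr s < diameter U powr s + e"
    by eventually_elim auto
  then obtain \<eta> :: real where \<eta>: "0 < \<eta>" "(diameter U + 2 * \<eta>) powr s < diameter U powr s + e"
    using eventually_happens'[OF trivial_limit_at_right_real] by blast
  define V where "V = (\<Union>x\<in>U. ball x \<eta>)"
  have near: "dist y z \<le> diameter U + 2 * \<eta>" if yz: "y \<in> V" "z \<in> V" for y z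
  proof -
    obtain a b where ab: "a \<in> U" "b \<in> U" "dist a y < \<eta>" "dist b z < \<eta>"
      using yz by (auto simp: V_def)
    have "dist a b \<le> diameter U"
      using ab assms(1) by (intro diameter_bounded_bound)
    moreover have "dist y z \<le> dist a y + dist a b + dist b z"
      by metric
    ultimately show ?thesis
      using ab by linarith
  qed
  show ?thesis
  proof (rule that[of V])
    show "open V" by (auto simp: V_def)
    show "U \<subseteq> V" using \<eta>(1) by (auto simp: V_def)
    show "bounded V" using near by (auto simp: bounded_two_points)
    then have "0 \<le> diameter V" by (rule diameter_ge_0)
    moreover have "diameter V \<le> diameter U + 2 * \<eta>"
      using near \<eta>(1) diameter_ge_0[OF assms(1)] by (intro diameter_le) (auto simp: dist_norm)
    ultimately have "diameter V powr s \<le> (diameter U + 2 * \<eta>) powr s"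
      using assms by (intro powr_mono2) auto
    then show "diameter V powr s \<le> diam_pow s U + e"
      using \<eta> False assms by (simp add: diam_pow_def)
  qed
qed

lemma hausdorff_measure_compact_neq_0:
  fixes K :: "'a::real_normed_vector set"
  assumes "compact K" "0 < s" "0 < c"
    and fin: "\<And>(U :: nat \<Rightarrow> 'a set) I. finite I \<Longrightarrow> K \<subseteq> (\<Union>i\<in>I. U i) \<Longrightarrow> (\<And>i. i \<in> I \<Longrightarrow> bounded (U i)) \<Longrightarrow>
           c \<le> (\<Sum>i\<in>I. diameter (U i) powr s)"
  shows "hausdorff_measure s K \<noteq> 0"
proof -
  have "ennreal c \<le> (\<Sum>i. ennreal (diam_pow s (U i)))" if U: "U \<in> delta_covers 1 K" for U
  proof (rule ennreal_le_epsilon)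
    fix e :: real assume e: "0 < e"
    have "\<exists>V. open V \<and> bounded V \<and> U i \<subseteq> V \<and> diameter V powr s \<le> diam_pow s (U i) + e * (1/2)^Suc i" for i
    proof -
      have "bounded (U i)" "0 < e * (1/2)^Suc i" using U e by (auto simp: delta_covers_def)
      then show ?thesis using diameter_powr_thicken[OF _ assms(2)] by metis
    qed
    then obtain V where V: "\<And>i. open (V i)" "\<And>i. bounded (V i)" "\<And>i. U i \<subseteq> V i"
      "\<And>i. diameter (V i) powr s \<le> diam_pow s (U i) + e * (1/2)^Suc i"
      by metis
    have "K \<subseteq> (\<Union>i\<in>UNIV. V i)"
      using U V(3) by (fastforce simp: delta_covers_def)
    then obtain I where I: "finite I" "K \<subseteq> (\<Union>i\<in>I. V i)"
      using compactE_image[OF assms(1), of UNIV V] V(1) by auto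
    have nn: "0 \<le> diam_pow s (U i)" for i
      by (simp add: diam_pow_def)
    have "ennreal c \<le> ennreal (\<Sum>i\<in>I. diameter (V i) powr s)"
      using fin[OF I V(2)] by (rule ennreal_leI)
    also have "\<dots> \<le> ennreal (\<Sum>i\<in>I. diam_pow s (U i) + e * (1/2)^Suc i)"
      by (intro ennreal_leI sum_mono V)
    also have "\<dots> = (\<Sum>i\<in>I. ennreal (diam_pow s (U i)) + ennreal (e * (1/2)^Suc i))"
      using e nn by (subst sum_ennreal[symmetric]) auto
    also have "\<dots> \<le> (\<Sum>i. ennreal (diam_pow s (U i)) + ennreal (e * (1/2)^Suc i))"
      by (rule sum_le_suminf) (use I in auto)
    also have "\<dots> = (\<Sum>i. ennreal (diam_pow s (U i))) + (\<Sum>i. ennreal (e * (1/2)^Suc i))"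
      by (rule suminf_add[symmetric]) auto
    also have "(\<Sum>i. ennreal (e * (1/2)^Suc i)) = ennreal e"
      using sums_mult[OF power_half_series, of e] e by (intro suminf_ennreal_eq) auto
    finally show "ennreal c \<le> (\<Sum>i. ennreal (diam_pow s (U i))) + ennreal e" .
  qed
  then have "ennreal c \<le> hausdorff_premeasure s 1 K"
    unfolding hausdorff_premeasure_def by (rule INF_greatest)
  also have "\<dots> \<le> hausdorff_measure s K"
    unfolding hausdorff_measure_def by (rule SUP_upper) simp
  finally show ?thesis
    using assms(3) by auto
qed

section \<open>Self-similar sets with equal ratios\<close>

text \<open>If the sum were smaller than \<open>g powr s\<close>, then every set of the cover would have diameter below the
  gap \<open>g\<close> and so could meet only one of the pieces \<open>f i ` K\<close>: the cover splits into disjoint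
  subfamilies, one for each piece. Pulling back by \<open>f i\<close> the subfamily with the smallest sum, which
  is at most a fraction \<open>1 / card J\<close> of the total, gives a cover of \<open>K\<close> whose sum is at most the former
  one, since \<open>1 \<le> card J * \<rho> powr s\<close>, and which has strictly fewer members, since there are at least
  two pieces. This cannot go on forever.\<close>

lemma self_similar_cover_sum_ge:
  fixes f :: "'i \<Rightarrow> 'a::real_normed_vector \<Rightarrow> 'a"
  assumes J: "finite J" and K: "K \<noteq> {}" "K = (\<Union>i\<in>J. f i ` K)"
    and f: "\<And>i x y. i \<in> J \<Longrightarrow> dist (f i x) (f i y) = \<rho> * dist x y" and \<rho>: "0 < \<rho>" "\<rho> < 1"
    and gap: "\<And>i i' x y. i \<in> J \<Longrightarrow> i' \<in> J \<Longrightarrow> i \<noteq> i' \<Longrightarrow> x \<in> f i ` K \<Longrightarrow> y \<in> f i' ` K \<Longrightarrow> g \<le> dist x y"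
    and "0 < g" and s: "0 < s" "1 \<le> card J * \<rho> powr s"
    and "finite I" "K \<subseteq> (\<Union>k\<in>I. U k)" "\<And>k. k \<in> I \<Longrightarrow> bounded (U k)"
  shows "g powr s \<le> (\<Sum>k\<in>I. diameter (U k) powr s)"
  using assms(11-13)
proof (induction "card I" arbitrary: I U rule: less_induct)
  case less
  show ?case
  proof (rule ccontr)
    assume small: "\<not> ?thesis"
    have diam: "diameter (U k) < g" if "k \<in> I" for k
    proof (rule ccontr)
      assume "\<not> diameter (U k) < g"
      then have "g powr s \<le> diameter (U k) powr s"
        using \<open>0 < g\<close> s by (intro powr_mono2) auto
      also have "\<dots> \<le> (\<Sum>k\<in>I. diameter (U k) powr s)"
        by (rule member_le_sum) (use that less.prems in auto)
      finally show False using small by simp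
    qed
    define N where "N i = {k \<in> I. U k \<inter> f i ` K \<noteq> {}}" for i
    have N: "N i \<subseteq> I" "finite (N i)" for i
      using less.prems by (auto simp: N_def)
    have N_ne: "N i \<noteq> {}" if "i \<in> J" for i
    proof -
      obtain x where "x \<in> K" using K(1) by auto
      then have "f i x \<in> K" using K(2) that by blast
      then obtain k where "k \<in> I" "f i x \<in> U k" using less.prems(2) by auto
      then show ?thesis using \<open>x \<in> K\<close> by (auto simp: N_def)
    qed
    have N_disj: "N i \<inter> N i' = {}" if "i \<in> J" "i' \<in> J" "i \<noteq> i'" for i i'
    proof (rule ccontr)
      assume "N i \<inter> N i' \<noteq> {}"
      then obtain k x y where k: "k \<in> I" "x \<in> U k" "y \<in> U k" "x \<in> f i ` K" "y \<in> f i' ` K"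
        by (auto simp: N_def)
      then have "dist x y \<le> diameter (U k)"
        using less.prems(3) by (intro diameter_bounded_bound)
      with gap[OF that k(4,5)] diam[OF k(1)] show False by simp
    qed
    have "1 < card J"
    proof (rule ccontr)
      assume "\<not> 1 < card J"
      then have "card J * \<rho> powr s \<le> 1 * \<rho> powr s"
        by (intro mult_right_mono) auto
      also have "\<dots> < 1 powr s" using \<rho> s powr_less_mono2[of s \<rho> 1] by simp
      finally show False using s by simp
    qed
    define \<Sigma> where "\<Sigma> L = (\<Sum>k\<in>L. diameter (U k) powr s)" for L
    have "(\<Sum>i\<in>J. \<Sigma> (N i)) = \<Sigma> (\<Union>i\<in>J. N i)"
      unfolding \<Sigma>_def by (rule sum.UNION_disjoint[symmetric]) (use J N N_disj in auto)
    also have "\<dots> \<le> \<Sigma> I"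
      unfolding \<Sigma>_def by (rule sum_mono2) (use less.prems N in auto)
    finally have total: "(\<Sum>i\<in>J. \<Sigma> (N i)) \<le> \<Sigma> I" .
    \<comment> \<open>The piece whose share of the cover is at most the average.\<close>
    have "\<exists>i\<in>J. card J * \<Sigma> (N i) \<le> \<Sigma> I"
    proof (rule ccontr)
      assume "\<not> ?thesis"
      then have "(\<Sum>i\<in>J. \<Sigma> I) < (\<Sum>i\<in>J. card J * \<Sigma> (N i))"
        using J \<open>1 < card J\<close> by (intro sum_strict_mono) auto
      also have "\<dots> \<le> card J * \<Sigma> I"
        using total by (simp add: sum_distrib_left[symmetric] mult_left_mono)
      finally show False by simp
    qed
    then obtain i where i: "i \<in> J" "card J * \<Sigma> (N i) \<le> \<Sigma> I" by blast
    obtain i' where i': "i' \<in> J" "i' \<noteq> i"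
      using \<open>1 < card J\<close> i(1) J by (metis card_le_Suc0_iff_eq not_less One_nat_def)
    have "N i \<subset> I"
      using N[of i] N[of i'] N_ne[OF i'(1)] N_disj[OF i(1) i'(1)] i' by blast
    then have smaller: "card (N i) < card I"
      using less.prems by (intro psubset_card_mono)
    define V where "V k = {x. f i x \<in> U k}" for k
    have V: "dist x y \<le> diameter (U k) / \<rho>" if "k \<in> N i" "x \<in> V k" "y \<in> V k" for k x y
    proof -
      have "\<rho> * dist x y \<le> diameter (U k)"
        using that less.prems(3) N(1)[of i] unfolding f[OF i(1), symmetric]
        by (auto simp: V_def intro!: diameter_bounded_bound)
      then show ?thesis using \<rho> by (simp add: field_simps)
    qed
    have V_bdd: "bounded (V k)" if "k \<in> N i" for k
      unfolding bounded_two_points using V[OF that] by blast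
    have "K \<subseteq> (\<Union>k\<in>N i. V k)"
    proof
      fix x assume "x \<in> K"
      then have "f i x \<in> K" using K(2) i(1) by blast
      then obtain k where "k \<in> I" "f i x \<in> U k" using less.prems(2) by auto
      then show "x \<in> (\<Union>k\<in>N i. V k)" using \<open>x \<in> K\<close> by (auto simp: N_def V_def)
    qed
    then have "g powr s \<le> (\<Sum>k\<in>N i. diameter (V k) powr s)"
      using less.hyps[OF smaller, of V] N V_bdd by auto
    also have "\<dots> \<le> (\<Sum>k\<in>N i. (diameter (U k) / \<rho>) powr s)"
    proof (intro sum_mono powr_mono2)
      fix k assume k: "k \<in> N i"
      show "0 \<le> diameter (V k)" using V_bdd[OF k] by (rule diameter_ge_0)
      have "0 \<le> diameter (U k) / \<rho>"
        using k N(1) less.prems(3) \<rho> by (intro divide_nonneg_pos diameter_ge_0) auto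
      then show "diameter (V k) \<le> diameter (U k) / \<rho>"
        using V[OF k] by (intro diameter_le) (auto simp: dist_norm)
    qed (use s in auto)
    also have "\<dots> = \<Sigma> (N i) / \<rho> powr s"
      unfolding \<Sigma>_def sum_divide_distrib
by (intro sum.cong refl powr_divide)
    also have "\<dots> \<le> card J * \<Sigma> (N i)"
    proof -
      have "0 \<le> \<Sigma> (N i)" by (simp add: \<Sigma>_def sum_nonneg)
      with s(2) have "1 * \<Sigma> (N i) \<le> (card J * \<rho> powr s) * \<Sigma> (N i)"
        by (rule mult_right_mono)
      then show ?thesis using \<rho> by (simp add: field_simps)
    qed
    also have "\<dots> \<le> \<Sigma> I" by (rule i)
    finally show False using small by (simp add: \<Sigma>_def)
  qed
qed

lemma finite_disjoint_compact_gap: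
  fixes C :: "'i \<Rightarrow> 'a::heine_borel set"
  assumes "finite J" "\<And>i. i \<in> J \<Longrightarrow> compact (C i)" "disjoint_family_on C J"
  obtains g where "0 < g"
    "\<And>i i' x y. i \<in> J \<Longrightarrow> i' \<in> J \<Longrightarrow> i \<noteq> i' \<Longrightarrow> x \<in> C i \<Longrightarrow> y \<in> C i' \<Longrightarrow> g \<le> dist x y"
proof -
  let ?D = "{p \<in> J \<times> J. fst p \<noteq> snd p}"
  have "\<forall>p\<in>?D. \<exists>g. 0 < g \<and> (\<forall>x\<in>C (fst p). \<forall>y\<in>C (snd p). g \<le> dist x y)"
  proof
    fix p assume "p \<in> ?D"
    then have "compact (C (fst p))" "compact (C (snd p))" "C (fst p) \<inter> C (snd p) = {}"
      using assms(2) disjoint_family_onD[OF assms(3), of "fst p" "snd p"] by auto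
    then show "\<exists>g. 0 < g \<and> (\<forall>x\<in>C (fst p). \<forall>y\<in>C (snd p). g \<le> dist x y)"
      using separate_compact_closed[of "C (fst p)" "C (snd p)"] by (auto simp: compact_imp_closed)
  qed
  from bchoice[OF this] obtain g where
    g: "\<forall>p\<in>?D. 0 < g p \<and> (\<forall>x\<in>C (fst p). \<forall>y\<in>C (snd p). g p \<le> dist x y)" ..
  have fin: "finite (insert 1 (g ` ?D))"
    using assms(1) by auto
  show ?thesis
  proof (rule that[of "Min (insert 1 (g ` ?D))"])
    show "0 < Min (insert 1 (g ` ?D))"
      using fin g by (subst Min_gr_iff) auto
    fix i i' x y assume *: "i \<in> J" "i' \<in> J" "i \<noteq> i'" "x \<in> C i" "y \<in> C i'"
    then have "Min (insert 1 (g ` ?D)) \<le> g (i, i')"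
      using fin by (intro Min_le) auto
    also have "\<dots> \<le> dist x y"
      using bspec[OF g, of "(i, i')"] * by auto
    finally show "Min (insert 1 (g ` ?D)) \<le> dist x y" .
  qed
qed

text \<open>These covers show that some exponent has measure zero; the infimum that defines the dimension
  is then over a nonempty set.\<close>

lemma self_similar_level_cover:
  fixes f :: "'i \<Rightarrow> 'a::real_normed_vector \<Rightarrow> 'a"
  assumes "finite J" "bounded K" "K = (\<Union>i\<in>J. f i ` K)" "0 < \<rho>"
    and "\<And>i x y. i \<in> J \<Longrightarrow> dist (f i x) (f i y) = \<rho> * dist x y"
  shows "\<exists>\<U>. finite \<U> \<and> K \<subseteq> \<Union>\<U> \<and> (\<forall>U\<in>\<U>. bounded U \<and> diameter U \<le> \<rho> ^ n * diameter K) \<and>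
           card \<U> \<le> card J ^ n"
proof (induction n)
  case 0
  then show ?case using assms(2) by (intro exI[of _ "{K}"]) auto
next
  case (Suc n)
  then obtain \<U> where U: "finite \<U>" "K \<subseteq> \<Union>\<U>" "\<And>U. U\<in>\<U> \<Longrightarrow> bounded U \<and> diameter U \<le> \<rho> ^ n * diameter K"
    "card \<U> \<le> card J ^ n" by blast
  let ?V = "(\<lambda>(i, U). f i ` U) ` (J \<times> \<U>)"
  have "bounded (f i ` U) \<and> diameter (f i ` U) \<le> \<rho> ^ Suc n * diameter K" if "i \<in> J" "U \<in> \<U>" for i U
  proof
    have *: "dist x y \<le> \<rho> ^ Suc n * diameter K" if xy: "x \<in> f i ` U" "y \<in> f i ` U" for x y
    proof -
      obtain a b where ab: "a \<in> U" "b \<in> U" "x = f i a" "y = f i b" using xy by auto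
      have "dist a b \<le> diameter U" using ab U(3)[OF \<open>U \<in> \<U>\<close>] by (intro diameter_bounded_bound) auto
      also have "\<dots> \<le> \<rho> ^ n * diameter K" using U(3)[OF \<open>U \<in> \<U>\<close>] by auto
      finally show ?thesis using assms(4) by (simp add: ab assms(5)[OF \<open>i \<in> J\<close>])
    qed
    then show "bounded (f i ` U)" unfolding bounded_two_points by blast
    have "0 \<le> \<rho> ^ Suc n * diameter K"
      using assms(2,4) by (intro mult_nonneg_nonneg diameter_ge_0) auto
    with * show "diameter (f i ` U) \<le> \<rho> ^ Suc n * diameter K"
      by (intro diameter_le) (auto simp: dist_norm)
  qed
  moreover have "K \<subseteq> \<Union>?V"
  proof
    fix x assume "x \<in> K"
    then obtain i y where "i \<in> J" "y \<in> K" "x = f i y" using assms(3) by blast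
    moreover obtain U where "U \<in> \<U>" "y \<in> U" using U(2) \<open>y \<in> K\<close> by blast
    ultimately show "x \<in> \<Union>?V" by blast
  qed
  moreover have "card ?V \<le> card J ^ Suc n"
  proof -
    have "card ?V \<le> card (J \<times> \<U>)" using assms(1) U(1) by (intro card_image_le) auto
    also have "\<dots> \<le> card J * card J ^ n" using U(4) by (simp add: card_cartesian_product)
    finally show ?thesis by simp
  qed
  ultimately show ?case using assms(1) U(1) by (intro exI[of _ ?V]) auto
qed

lemma self_similar_hausdorff_dim_ge:
  fixes f :: "'i \<Rightarrow> 'a::euclidean_space \<Rightarrow> 'a"
  assumes J: "finite J" and K: "compact K" "K \<noteq> {}" "K = (\<Union>i\<in>J. f i ` K)"
    and disj: "disjoint_family_on (\<lambda>i. f i ` K) J"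
    and f: "\<And>i x y. i \<in> J \<Longrightarrow> dist (f i x) (f i y) = \<rho> * dist x y" and \<rho>: "0 < \<rho>" "\<rho> < 1"
    and t: "0 \<le> t" "1 \<le> card J * \<rho> powr t"
  shows "t \<le> hausdorff_dim K"
proof -
  have "J \<noteq> {}" using K by auto
  then have m: "1 \<le> card J" using J by (simp add: Suc_leI card_gt_0_iff)
  \<comment> \<open>An exponent beyond the similarity dimension: \<open>card J * \<rho> powr s\<^sub>0 = exp (- 1)\<close>.\<close>
  define s\<^sub>0 where "s\<^sub>0 = (ln (card J) + 1) / - ln \<rho>"
  have s0: "0 < s\<^sub>0" unfolding s\<^sub>0_def using m \<rho> by (intro divide_pos_pos add_nonneg_pos) auto
  have "card J * \<rho> powr s\<^sub>0 = exp (ln (card J)) * exp (- (ln (card J) + 1))"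
    using \<rho> m by (simp add: powr_def s\<^sub>0_def)
  also have "\<dots> = exp (-1)" by (simp add: exp_add[symmetric] del: exp_ln)
  finally have q: "card J * \<rho> powr s\<^sub>0 = exp (-1)" .
  have "hausdorff_measure s\<^sub>0 K = 0"
  proof (rule hausdorff_measure_eq_0I[OF s0])
    fix e :: real assume e: "0 < e"
    have "(\<lambda>n. \<rho> ^ n * diameter K) \<longlonglongrightarrow> 0 * diameter K"
      using \<rho> by (intro tendsto_mult LIMSEQ_power_zero tendsto_const) auto
    then have 1: "\<forall>\<^sub>F n in sequentially. \<rho> ^ n * diameter K < e"
      by (rule order_tendstoD) (use e in auto)
    have "(\<lambda>n. exp (-1::real) ^ n * diameter K powr s\<^sub>0) \<longlonglongrightarrow> 0 * diameter K powr s\<^sub>0"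
      by (intro tendsto_mult LIMSEQ_power_zero tendsto_const) auto
    then have 2: "\<forall>\<^sub>F n in sequentially. exp (-1::real) ^ n * diameter K powr s\<^sub>0 < e"
      by (rule order_tendstoD) (use e in auto)
    obtain n where n: "\<rho> ^ n * diameter K < e" "exp (-1::real) ^ n * diameter K powr s\<^sub>0 < e"
      using eventually_happens'[OF _ eventually_conj[OF 1 2]] by auto
    obtain \<U> where U: "finite \<U>" "K \<subseteq> \<Union>\<U>" "\<forall>U\<in>\<U>. bounded U \<and> diameter U \<le> \<rho> ^ n * diameter K"
      "card \<U> \<le> card J ^ n"
      using self_similar_level_cover[OF J compact_imp_bounded[OF K(1)] K(3) \<rho>(1) f] by blast
    have "(\<rho> ^ n) powr s\<^sub>0 = (\<rho> powr s\<^sub>0) ^ n"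
      using \<rho> by (simp add: powr_powr mult.commute flip: powr_realpow)
    then have pw: "(\<rho> ^ n * diameter K) powr s\<^sub>0 = (\<rho> powr s\<^sub>0) ^ n * diameter K powr s\<^sub>0"
      by (simp add: powr_mult)
    have "card \<U> * (\<rho> ^ n * diameter K) powr s\<^sub>0 \<le> card J ^ n * (\<rho> ^ n * diameter K) powr s\<^sub>0"
      using U(4) by (intro mult_right_mono) (simp_all flip: of_nat_power)
    also have "\<dots> = (card J * \<rho> powr s\<^sub>0) ^ n * diameter K powr s\<^sub>0"
      unfolding pw by (simp add: power_mult_distrib)
    also have "\<dots> \<le> e" using n q by simp
    finally show "\<exists>\<U> d. finite \<U> \<and> K \<subseteq> \<Union>\<U> \<and> (\<forall>U\<in>\<U>. bounded U \<and> diameter U \<le> d) \<and>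
           d \<le> e \<and> real (card \<U>) * d powr s\<^sub>0 \<le> e"
      using U n by (intro exI[of _ \<U>] exI[of _ "\<rho> ^ n * diameter K"]) auto
  qed
  moreover have "hausdorff_measure s K \<noteq> 0" if s: "0 \<le> s" "s < t" for s
  proof (cases "s = 0")
    case True
    then show ?thesis using hausdorff_measure_0_neq_0 K by blast
  next
    case False
    have "compact (f i ` K)" if "i \<in> J" for i
      using that K(1) f \<rho>
      by (intro compact_continuous_image lipschitz_on_continuous_on[of \<rho>] lipschitz_onI) auto
    then obtain g where g: "0 < g"
      "\<And>i i' x y. i \<in> J \<Longrightarrow> i' \<in> J \<Longrightarrow> i \<noteq> i' \<Longrightarrow> x \<in> f i ` K \<Longrightarrow> y \<in> f i' ` K \<Longrightarrow> g \<le> dist x y"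
      using finite_disjoint_compact_gap[OF J _ disj] by blast
    have "card J * \<rho> powr t \<le> card J * \<rho> powr s"
      using s \<rho> by (intro mult_left_mono powr_mono') auto
    with t have "1 \<le> card J * \<rho> powr s" by linarith
    then show ?thesis
      using False s g(1)
      by (intro hausdorff_measure_compact_neq_0[OF K(1), of s "g powr s"]
          self_similar_cover_sum_ge[OF J K(2,3) f \<rho> g(2,1)]) auto
  qed
  ultimately show ?thesis
    using s0 by (intro hausdorff_dim_ge[of s\<^sub>0]) auto
qed

text \<open>The attractor is the intersection of the decreasing sequence of iterated images of \<open>X\<close>. That it is
  contained in the union of its own images is the point where compactness enters.\<close>

lemma attractor_in_invariant_compact:
  fixes f :: "'i \<Rightarrow> 'a::heine_borel \<Rightarrow> 'a"
  assumes "compact X" "X \<noteq> {}" "finite J" "J \<noteq> {}"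
    and f: "\<And>i. i \<in> J \<Longrightarrow> continuous_on UNIV (f i)" "\<And>i. i \<in> J \<Longrightarrow> f i ` X \<subseteq> X"
  obtains K where "K \<subseteq> X" "K \<noteq> {}" "compact K" "K = (\<Union>i\<in>J. f i ` K)"
proof -
  define \<Phi> where "\<Phi> Y = (\<Union>i\<in>J. f i ` Y)" for Y
  define Z where "Z n = (\<Phi> ^^ n) X" for n
  have Z_Suc: "Z (Suc n) = \<Phi> (Z n)" for n by (simp add: Z_def)
  have \<Phi>_mono: "\<Phi> Y \<subseteq> \<Phi> Y'" if "Y \<subseteq> Y'" for Y Y' using that by (auto simp: \<Phi>_def)
  have cont: "continuous_on Y (f i)" if "i \<in> J" for i Y
    using f(1)[OF that] by (rule continuous_on_subset) auto
  have Z: "compact (Z n) \<and> Z n \<noteq> {}" for n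
  proof (induction n)
    case (Suc n)
    then show ?case using assms(3,4) cont
      by (auto simp: Z_Suc \<Phi>_def intro!: compact_UN compact_continuous_image)
  qed (use assms in \<open>auto simp: Z_def\<close>)
  have "Z (Suc n) \<subseteq> Z n" for n
  proof (induction n)
    case 0 then show ?case using f(2) by (auto simp: Z_def \<Phi>_def)
  next
    case (Suc n) then show ?case unfolding Z_Suc[of "Suc n"] Z_Suc[of n] by (rule \<Phi>_mono)
  qed
  then have anti: "Z n \<subseteq> Z m" if "m \<le> n" for m n
    using lift_Suc_antimono_le[of Z] that by blast
  define K where "K = \<Inter>(range Z)"
  have "K \<subseteq> Z 0" by (auto simp: K_def)
  then have "K \<subseteq> X" by (simp add: Z_def)
  moreover have "K \<noteq> {}"
    unfolding K_def by (rule compact_nest) (use Z anti in auto)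
  moreover have "compact K"
    unfolding K_def using Z by (intro compact_Inter) auto
  moreover have "\<Phi> K \<subseteq> K"
  proof -
    have "\<Phi> K \<subseteq> Z n" for n
    proof -
      have "\<Phi> K \<subseteq> \<Phi> (Z n)" by (rule \<Phi>_mono) (auto simp: K_def)
      also have "\<dots> \<subseteq> Z n" using anti[of n "Suc n"] by (simp add: Z_Suc)
      finally show ?thesis .
    qed
    then show ?thesis by (auto simp: K_def)
  qed
  moreover have "K \<subseteq> \<Phi> K"
  proof
    fix y assume y: "y \<in> K"
    \<comment> \<open>By the finiteness of \<open>J\<close> one index serves for arbitrarily late stages, hence for all.\<close>
    have "\<exists>i\<in>J. \<forall>n. y \<in> f i ` Z n"
    proof (rule ccontr)
      assume "\<not> ?thesis"
      then obtain n where n: "\<And>i. i \<in> J \<Longrightarrow> y \<notin> f i ` Z (n i)" by metis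
      have "y \<in> Z (Suc (Max (n ` J)))" using y by (auto simp: K_def)
      then obtain i where i: "i \<in> J" "y \<in> f i ` Z (Max (n ` J))" by (auto simp: Z_Suc \<Phi>_def)
      then have "y \<in> f i ` Z (n i)" using anti[of "n i" "Max (n ` J)"] assms(3) by (auto simp: image_subset_iff)
      with n i show False by blast
    qed
    then obtain i where i: "i \<in> J" "\<And>n. y \<in> f i ` Z n" by blast
    have "\<Inter>(range (\<lambda>n. Z n \<inter> f i -` {y})) \<noteq> {}"
    proof (rule compact_nest)
      show "compact (Z n \<inter> f i -` {y})" for n
        using Z f(1)[OF i(1)] by (intro compact_Int_closed continuous_closed_vimage) (auto simp: continuous_on_eq_continuous_at)
      show "Z n \<inter> f i -` {y} \<noteq> {}" for n using i(2)[of n] by auto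
      show "Z n \<inter> f i -` {y} \<subseteq> Z m \<inter> f i -` {y}" if "m \<le> n" for m n using anti[OF that] by auto
    qed
    then show "y \<in> \<Phi> K" using i(1) by (auto simp: \<Phi>_def K_def)
  qed
  ultimately show ?thesis using that[of K] by (auto simp: \<Phi>_def)
qed

section \<open>Approximation in the closure of a matrix semigroup\<close>

lemma op_norm_nonneg: "0 \<le> op_norm B"
  unfolding op_norm_def by (rule onorm_pos_le) simp

lemma op_norm_zero: "op_norm 0 = 0"
proof -
  have "(*v) (0 :: real^'a^'a) = (\<lambda>x. 0)" by (simp add: fun_eq_iff)
  then show ?thesis by (simp add: op_norm_def onorm_zero)
qed

lemma op_norm_triangle: "op_norm (B + C) \<le> op_norm B + op_norm C"
proof -
  have "(*v) (B + C) = (\<lambda>x. B *v x + C *v x)" by (simp add: fun_eq_iff matrix_vector_mult_add_rdistrib)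
  then show ?thesis
    unfolding op_norm_def using onorm_triangle[of "(*v) B" "(*v) C"] by simp
qed

lemma op_norm_mult: "op_norm (B ** C) \<le> op_norm B * op_norm C"
proof -
  have "(*v) (B ** C) = (*v) B \<circ> (*v) C" by (simp add: fun_eq_iff matrix_vector_mul_assoc)
  then show ?thesis
    unfolding op_norm_def using onorm_compose[of "(*v) B" "(*v) C"] by simp
qed

lemma op_norm_minus_commute: "op_norm (B - C) = op_norm (C - B)"
proof -
  have "(*v) (B - C) = (\<lambda>x. - ((C - B) *v x))"
    by (simp add: fun_eq_iff matrix_vector_mult_diff_rdistrib)
  then show ?thesis unfolding op_norm_def using onorm_neg[of "(*v) (C - B)"] by simp
qed

lemma matrix_mult_diff:
  fixes B C :: "real^'n^'m"
  shows "P ** (B - C) = P ** B - P ** C" "(B - C) ** R = B ** R - C ** R"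
  by (simp_all add: matrix_matrix_mult_def vec_eq_iff sum_subtractf right_diff_distrib left_diff_distrib)

lemma op_norm_triangle_le: "op_norm (B - D) \<le> op_norm (B - C) + op_norm (C - D)"
  using op_norm_triangle[of "B - C" "C - D"] by simp

lemma op_norm_orthogonal:
  assumes "orthogonal_matrix P"
  shows "op_norm P \<le> 1"
  unfolding op_norm_def
proof (rule onorm_le)
  show "norm (P *v x) \<le> 1 * norm x" for x
    using assms orthogonal_transformation_norm[of "(*v) P" x]
    by (simp add: orthogonal_transformation_matrix)
qed

lemma op_norm_orthogonal_mult:
  assumes "orthogonal_matrix P"
  shows "op_norm (P ** B) \<le> op_norm B" "op_norm (B ** P) \<le> op_norm B"
proof -
  show "op_norm (P ** B) \<le> op_norm B"
    using op_norm_mult[of P B] mult_right_mono[OF op_norm_orthogonal[OF assms] op_norm_nonneg, of B] by simp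
  show "op_norm (B ** P) \<le> op_norm B"
    using op_norm_mult[of B P] mult_left_mono[OF op_norm_orthogonal[OF assms] op_norm_nonneg, of B] by simp
qed

text \<open>The Euclidean norm induces the topology of the matrix type; this links it to the operator norm.\<close>

lemma op_norm_le_norm:
  fixes B :: "real^'d^'d"
  shows "op_norm B \<le> real (CARD('d) * CARD('d)) * norm B"
proof -
  have "op_norm B \<le> (\<Sum>i\<in>UNIV. \<Sum>j\<in>UNIV. \<bar>B $ i $ j\<bar>)"
    unfolding op_norm_def by (rule onorm_le_matrix_component_sum)
  also have "\<dots> \<le> (\<Sum>i::'d\<in>UNIV. \<Sum>j::'d\<in>UNIV. norm B)"
    by (intro sum_mono) (metis component_le_norm_cart order_trans Finite_Cartesian_Product.norm_nth_le real_norm_def)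
  finally show ?thesis by simp
qed

lemma bounded_orthogonal: "bounded {P :: real^'d^'d. orthogonal_matrix P}"
proof -
  have "norm P \<le> real (CARD('d) * CARD('d))" if "orthogonal_matrix P" for P :: "real^'d^'d"
  proof -
    have "\<bar>P $ i $ j\<bar> \<le> 1" for i j
    proof -
      have "\<bar>P $ i $ j\<bar> \<le> op_norm P"
        unfolding op_norm_def by (rule matrix_component_le_onorm) 
      then show ?thesis using op_norm_orthogonal[OF that] by linarith
    qed
    then have "norm (P $ i) \<le> real CARD('d)" for i
      using norm_le_l1_cart[of "P $ i"] sum_bounded_above[of UNIV "\<lambda>j. \<bar>P $ i $ j\<bar>" 1] by fastforce
    then have "(\<Sum>i\<in>UNIV. norm (P $ i)) \<le> real CARD('d) * real CARD('d)"
      using sum_bounded_above[of UNIV "\<lambda>i. norm (P $ i)" "real CARD('d)"] by simp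
    moreover have "norm P \<le> (\<Sum>i\<in>UNIV. norm (P $ i))"
      unfolding norm_vec_def[of P] by (rule L2_set_le_sum) simp
    ultimately show ?thesis by simp
  qed
  then show ?thesis by (intro boundedI) auto
qed

lemma orthogonal_finite_net:
  fixes X :: "(real^'d^'d) set"
  assumes "X \<subseteq> {P. orthogonal_matrix P}" "0 < \<eta>"
  shows "\<exists>N. finite N \<and> N \<subseteq> X \<and> (\<forall>P\<in>X. \<exists>P'\<in>N. op_norm (P - P') < \<eta>)"
proof -
  define \<delta> where "\<delta> = \<eta> / (2 * real (CARD('d) * CARD('d)))"
  have \<delta>: "0 < \<delta>" using assms(2) by (simp add: \<delta>_def)
  have "bounded X" using bounded_orthogonal assms(1) by (rule bounded_subset)
  then have "compact (closure X)" by simp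
  then obtain C where C: "finite C" "closure X \<subseteq> (\<Union>c\<in>C. ball c \<delta>)"
    using \<delta> unfolding compact_eq_totally_bounded by blast
  define p where "p c = (SOME P. P \<in> X \<inter> ball c \<delta>)" for c
  have p: "p c \<in> X \<inter> ball c \<delta>" if "X \<inter> ball c \<delta> \<noteq> {}" for c
    unfolding p_def using that by (metis someI_ex ex_in_conv)
  let ?N = "p ` {c \<in> C. X \<inter> ball c \<delta> \<noteq> {}}"
  show ?thesis
  proof (intro exI[of _ ?N] conjI ballI)
    show "finite ?N" using C by auto
    show "?N \<subseteq> X" using p by auto
    fix P assume P: "P \<in> X"
    then obtain c where c: "c \<in> C" "P \<in> ball c \<delta>"
      using C(2) closure_subset[of X] by blast
    then have pc: "p c \<in> ball c \<delta>" "p c \<in> ?N" using p P by blast+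
    have "dist P (p c) < 2 * \<delta>"
      using c(2) pc(1) dist_triangle_less_add[of P c \<delta> "p c" \<delta>] by (simp add: dist_commute)
    then have "real (CARD('d) * CARD('d)) * norm (P - p c) < real (CARD('d) * CARD('d)) * (2 * \<delta>)"
      by (intro mult_strict_left_mono) (auto simp: dist_norm)
    also have "\<dots> = \<eta>" by (simp add: \<delta>_def)
    finally have "op_norm (P - p c) < \<eta>" using op_norm_le_norm[of "P - p c"] by simp
    then show "\<exists>P'\<in>?N. op_norm (P - P') < \<eta>" using pc(2) by blast
  qed
qed

fun matrix_power :: "real^'d^'d \<Rightarrow> nat \<Rightarrow> real^'d^'d" where
  "matrix_power P 0 = mat 1"
| "matrix_power P (Suc n) = P ** matrix_power P n"

lemma matrix_power_add: "matrix_power P (m + n) = matrix_power P m ** matrix_power P n"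
  by (induction m) (auto simp: matrix_mul_assoc)

lemma orthogonal_matrix_power: "orthogonal_matrix P \<Longrightarrow> orthogonal_matrix (matrix_power P n)"
  by (induction n) (auto simp: orthogonal_matrix_id orthogonal_matrix_mul)

lemma orthogonal_transpose_mult:
  assumes "orthogonal_matrix P"
  shows "transpose P ** P = mat 1" "P ** transpose P = mat 1"
    "transpose P ** (P ** B) = B" "P ** (transpose P ** B) = B"
  using assms by (auto simp: orthogonal_matrix_def matrix_mul_assoc)

text \<open>Two of the powers of \<open>P\<close> lie close together by total boundedness; multiplication by
  the inverse of the lower one, an isometry, brings their quotient close to the identity.\<close>

lemma orthogonal_power_near_transpose:
  fixes P :: "real^'d^'d"
  assumes P: "orthogonal_matrix P" and "0 < \<eta>"
  obtains n where "0 < n" "op_norm (matrix_power P n - transpose P) < \<eta>"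
proof -
  \<comment> \<open>Even exponents differ by at least two, so that one factor can be split off from the quotient.\<close>
  let ?X = "range (\<lambda>n. matrix_power P (2 * n))"
  have "?X \<subseteq> {R. orthogonal_matrix R}" "0 < \<eta> / 2"
    using orthogonal_matrix_power[OF P] assms(2) by auto
  from orthogonal_finite_net[OF this] obtain N
    where N: "finite N" "\<forall>R\<in>?X. \<exists>R'\<in>N. op_norm (R - R') < \<eta> / 2"
    by blast
  have "\<forall>n. \<exists>R'. R' \<in> N \<and> op_norm (matrix_power P (2 * n) - R') < \<eta> / 2"
    using N(2) by blast
  then obtain c where c: "\<And>n. c n \<in> N" "\<And>n. op_norm (matrix_power P (2 * n) - c n) < \<eta> / 2"
    by metis
  have "\<not> inj c"
    using N(1) c(1) by (metis finite_subset image_subsetI infinite_UNIV_nat finite_imageD)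
  then obtain m n where "m \<noteq> n" "c m = c n" by (auto simp: inj_def)
  then obtain m n where mn: "m < n" "c m = c n" by (metis nat_neq_iff)
  define k where "k = 2 * n - 2 * m - 1"
  have k: "0 < k" "2 * n = Suc (2 * m) + k" using mn(1) by (auto simp: k_def)
  let ?R = "matrix_power P (Suc (2 * m))"
  have R: "orthogonal_matrix ?R" "orthogonal_matrix (transpose ?R)"
    using orthogonal_matrix_power[OF P] by (auto simp: orthogonal_matrix_transpose simp del: matrix_power.simps)
  have "?R ** (matrix_power P k - transpose P) = matrix_power P (2 * n) - ?R ** transpose P"
    by (simp add: matrix_mult_diff k(2) matrix_power_add[symmetric] del: matrix_power.simps)
  also have "?R ** transpose P = matrix_power P (2 * m)"
  proof -
    have "?R = matrix_power P (2 * m) ** P"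
      using matrix_power_add[of P "2 * m" 1] by simp
    then show ?thesis
      using orthogonal_transpose_mult(2)[OF P] by (simp add: matrix_mul_assoc[symmetric] del: matrix_power.simps)
  qed
  finally have "matrix_power P k - transpose P = transpose ?R ** (matrix_power P (2 * n) - matrix_power P (2 * m))"
    using orthogonal_transpose_mult(3)[OF R(1)] by metis
  then have "op_norm (matrix_power P k - transpose P) \<le> op_norm (matrix_power P (2 * n) - matrix_power P (2 * m))"
    using op_norm_orthogonal_mult(1)[OF R(2)] by simp
  also have "\<dots> \<le> op_norm (matrix_power P (2 * n) - c n) + op_norm (c n - matrix_power P (2 * m))"
    by (rule op_norm_triangle_le)
  also have "\<dots> < \<eta> / 2 + \<eta> / 2"
    using c(2)[of n] c(2)[of m] mn(2) by (intro add_strict_mono) (auto simp: op_norm_minus_commute)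
  finally show ?thesis using that[OF k(1)] by simp
qed

text \<open>The closure of \<open>\<Gamma>\<close> in the orthogonal group, expressed by the operator norm.\<close>

definition approximable :: "(real^'d^'d) set \<Rightarrow> (real^'d^'d) set" where
  "approximable \<Gamma> = {P. orthogonal_matrix P \<and> (\<forall>\<eta>>0. \<exists>B\<in>\<Gamma>. op_norm (B - P) < \<eta>)}"

lemma approximableD: "P \<in> approximable \<Gamma> \<Longrightarrow> 0 < \<eta> \<Longrightarrow> \<exists>B\<in>\<Gamma>. op_norm (B - P) < \<eta>"
  by (simp add: approximable_def)

lemma approximableI_approximable:
  assumes "orthogonal_matrix P" "\<And>\<eta>. 0 < \<eta> \<Longrightarrow> \<exists>B\<in>approximable \<Gamma>. op_norm (B - P) < \<eta>"
  shows "P \<in> approximable \<Gamma>"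
proof -
  have "\<exists>B\<in>\<Gamma>. op_norm (B - P) < \<eta>" if "0 < \<eta>" for \<eta>
  proof -
    have half: "0 < \<eta> / 2" using that by simp
    obtain B where B: "B \<in> approximable \<Gamma>" "op_norm (B - P) < \<eta> / 2"
      using assms(2)[OF half] by blast
    obtain C where C: "C \<in> \<Gamma>" "op_norm (C - B) < \<eta> / 2"
      using approximableD[OF B(1) half] by blast
    have "op_norm (C - P) < \<eta>" using op_norm_triangle_le[of C P B] B C by linarith
    with C show ?thesis by blast
  qed
  then show ?thesis using assms(1) by (auto simp: approximable_def)
qed

locale orthogonal_semigroup =
  fixes \<Gamma> :: "(real^'d^'d) set"
  assumes orthogonal: "P \<in> \<Gamma> \<Longrightarrow> orthogonal_matrix P"
    and mult_closed: "P \<in> \<Gamma> \<Longrightarrow> R \<in> \<Gamma> \<Longrightarrow> P ** R \<in> \<Gamma>"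
    and nonempty: "\<Gamma> \<noteq> {}"
begin

lemma subset_approximable: "P \<in> \<Gamma> \<Longrightarrow> P \<in> approximable \<Gamma>"
  by (auto simp: approximable_def op_norm_zero orthogonal intro!: bexI[of _ P])

lemma approximable_mult:
  assumes "P \<in> approximable \<Gamma>" "R \<in> approximable \<Gamma>"
  shows "P ** R \<in> approximable \<Gamma>"
proof -
  have PR: "orthogonal_matrix P" "orthogonal_matrix R" using assms by (auto simp: approximable_def)
  have "\<exists>B\<in>\<Gamma>. op_norm (B - P ** R) < \<eta>" if "0 < \<eta>" for \<eta>
  proof -
    have half: "0 < \<eta> / 2" using that by simp
    obtain B C where B: "B \<in> \<Gamma>" "op_norm (B - P) < \<eta> / 2" and C: "C \<in> \<Gamma>" "op_norm (C - R) < \<eta> / 2"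
      using approximableD[OF assms(1) half] approximableD[OF assms(2) half] by blast
    have "op_norm (B ** C - P ** R) \<le> op_norm (B ** C - B ** R) + op_norm (B ** R - P ** R)"
      by (rule op_norm_triangle_le)
    also have "B ** C - B ** R = B ** (C - R)" by (simp add: matrix_mult_diff)
    also have "B ** R - P ** R = (B - P) ** R" by (simp add: matrix_mult_diff)
    also have "op_norm (B ** (C - R)) + op_norm ((B - P) ** R) \<le> op_norm (C - R) + op_norm (B - P)"
      using op_norm_orthogonal_mult orthogonal[OF B(1)] PR by (intro add_mono) auto
    also have "\<dots> < \<eta>" using B C by linarith
    finally show ?thesis using mult_closed[OF B(1) C(1)] by blast
  qed
  then show ?thesis using PR by (auto simp: approximable_def orthogonal_matrix_mul)
qed

text \<open>The inverse of \<open>P\<close> is a limit of positive powers of \<open>P\<close>.\<close>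

lemma approximable_transpose:
  assumes "P \<in> approximable \<Gamma>"
  shows "transpose P \<in> approximable \<Gamma>"
proof (rule approximableI_approximable)
  have P: "orthogonal_matrix P" using assms by (auto simp: approximable_def)
  then show "orthogonal_matrix (transpose P)" by (simp add: orthogonal_matrix_transpose)
  fix \<eta> :: real assume "0 < \<eta>"
  then obtain n where n: "0 < n" "op_norm (matrix_power P n - transpose P) < \<eta>"
    by (rule orthogonal_power_near_transpose[OF P])
  have "matrix_power P (Suc m) \<in> approximable \<Gamma>" for m
    by (induction m) (auto simp: assms intro: approximable_mult)
  then have "matrix_power P n \<in> approximable \<Gamma>" using n(1) by (metis gr0_implies_Suc)
  with n show "\<exists>B\<in>approximable \<Gamma>. op_norm (B - transpose P) < \<eta>" by blast
qed

lemma approximable_one: "mat 1 \<in> approximable \<Gamma>"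
proof -
  obtain P where P: "P \<in> \<Gamma>" using nonempty by blast
  then have "transpose P ** P \<in> approximable \<Gamma>"
    by (intro approximable_mult approximable_transpose subset_approximable)
  then show ?thesis using orthogonal_transpose_mult(1)[OF orthogonal[OF P]] by simp
qed

lemma inv_orthogonal_group:
  assumes "orthogonal_matrix P"
  shows "inv\<^bsub>orthogonal_group\<^esub> P = transpose P"
  by (rule group.inv_equality[OF group_orthogonal_group])
     (use assms in \<open>auto simp: orthogonal_group_def orthogonal_matrix_transpose orthogonal_transpose_mult\<close>)

text \<open>The closure of a semigroup in a compact group is a group.\<close>

lemma generate_subset_approximable: "generate orthogonal_group \<Gamma> \<subseteq> approximable \<Gamma>"
proof
  fix P assume "P \<in> generate orthogonal_group \<Gamma>"
  then show "P \<in> approximable \<Gamma>"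
  proof induction
    case one
    then show ?case using approximable_one by (simp add: orthogonal_group_def)
  next
    case (incl h)
    then show ?case by (rule subset_approximable)
  next
    case (inv h)
    then show ?case by (simp add: inv_orthogonal_group orthogonal approximable_transpose subset_approximable)
  next
    case (eng h1 h2)
    then show ?case using approximable_mult by (simp add: orthogonal_group_def)
  qed
qed

lemma closure_subset_approximable:
  assumes "Q \<in> orthogonal_closure (generate orthogonal_group \<Gamma>)"
  shows "Q \<in> approximable \<Gamma>"
proof (rule approximableI_approximable)
  have "Q \<in> carrier orthogonal_group \<inter> closure (generate orthogonal_group \<Gamma>)"
    using assms unfolding orthogonal_closure_def
    by (auto simp: closure_of_subtopology dest: subsetD[OF closure_mono, rotated])
  then have Q: "orthogonal_matrix Q" "Q \<in> closure (generate orthogonal_group \<Gamma>)"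
    by (auto simp: orthogonal_group_def)
  then show "orthogonal_matrix Q" by simp
  fix \<eta> :: real assume \<eta>: "0 < \<eta>"
  let ?n = "real (CARD('d) * CARD('d))"
  have n: "0 < ?n" by simp
  obtain B where B: "B \<in> generate orthogonal_group \<Gamma>" "dist B Q < \<eta> / ?n"
    using Q(2) \<eta> unfolding closure_approachable by (meson divide_pos_pos n)
  have "op_norm (B - Q) \<le> ?n * dist B Q" unfolding dist_norm by (rule op_norm_le_norm)
  also have "\<dots> < \<eta>" using B(2) n by (metis mult.commute pos_less_divide_eq)
  finally show "\<exists>B\<in>approximable \<Gamma>. op_norm (B - Q) < \<eta>"
    using B(1) generate_subset_approximable by blast
qed

text \<open>A finite net of \<open>\<Gamma>\<close> reduces the choice of \<open>C\<close> for a given \<open>B\<close> to finitely many cases.\<close>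

lemma finite_correction:
  assumes "Q \<in> orthogonal_closure (generate orthogonal_group \<Gamma>)" "0 < \<eta>"
  shows "\<exists>W. finite W \<and> W \<subseteq> \<Gamma> \<and> (\<forall>B\<in>\<Gamma>. \<exists>C\<in>W. op_norm (C ** B - Q) < \<eta>)"
proof -
  have half: "\<Gamma> \<subseteq> {P. orthogonal_matrix P}" "0 < \<eta> / 2" using orthogonal assms(2) by auto
  from orthogonal_finite_net[OF this] obtain N where
    N: "finite N" "N \<subseteq> \<Gamma>" "\<forall>B\<in>\<Gamma>. \<exists>B'\<in>N. op_norm (B - B') < \<eta> / 2"
    by blast
  have "\<exists>C\<in>\<Gamma>. op_norm (C ** B' - Q) < \<eta> / 2" if "B' \<in> \<Gamma>" for B'
  proof -
    have "Q ** transpose B' \<in> approximable \<Gamma>"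
      using closure_subset_approximable[OF assms(1)] that
      by (auto intro: approximable_mult approximable_transpose subset_approximable)
    then obtain C where C: "C \<in> \<Gamma>" "op_norm (C - Q ** transpose B') < \<eta> / 2"
      using approximableD half(2) by blast
    have "C ** B' - Q = (C - Q ** transpose B') ** B'"
      using orthogonal_transpose_mult(1)[OF orthogonal[OF that]]
      by (simp add: matrix_mult_diff matrix_mul_assoc[symmetric])
    then have "op_norm (C ** B' - Q) < \<eta> / 2"
      using op_norm_orthogonal_mult(2)[OF orthogonal[OF that], of "C - Q ** transpose B'"] C(2) by simp
    with C show ?thesis by blast
  qed
  then obtain c where c: "\<And>B'. B' \<in> \<Gamma> \<Longrightarrow> c B' \<in> \<Gamma> \<and> op_norm (c B' ** B' - Q) < \<eta> / 2"
    by metis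
  show ?thesis
  proof (intro exI[of _ "c ` N"] conjI ballI)
    show "finite (c ` N)" "c ` N \<subseteq> \<Gamma>" using N c by auto
    fix B assume "B \<in> \<Gamma>"
    then obtain B' where B': "B' \<in> N" "op_norm (B - B') < \<eta> / 2" using N(3) by blast
    then have cB: "c B' \<in> \<Gamma>" "op_norm (c B' ** B' - Q) < \<eta> / 2" using c N(2) by blast+
    have "op_norm (c B' ** B - Q) \<le> op_norm (c B' ** B - c B' ** B') + op_norm (c B' ** B' - Q)"
      by (rule op_norm_triangle_le)
    also have "op_norm (c B' ** B - c B' ** B') \<le> op_norm (B - B')"
      using op_norm_orthogonal_mult(1)[OF orthogonal[OF cB(1)], of "B - B'"] by (simp add: matrix_mult_diff)
    finally show "\<exists>C\<in>c ` N. op_norm (C ** B - Q) < \<eta>" using B' cB(2) by (intro bexI[of _ "c B'"]) auto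
  qed
qed

end

section \<open>Admissible words\<close>

text \<open>The word \<open>w\<close> starts with \<open>i\<close>, is admissible and may be followed by \<open>k\<close>. Admitting the empty word
  for \<open>i = k\<close> makes concatenation and induction smooth.\<close>

fun links :: "nat \<Rightarrow> nat mat \<Rightarrow> nat \<Rightarrow> nat list \<Rightarrow> nat \<Rightarrow> bool" where
  "links M A i [] k \<longleftrightarrow> i = k"
| "links M A i (a # w) k \<longleftrightarrow> a = i \<and> i < M \<and> (\<exists>b<M. A $$ (i, b) = 1 \<and> links M A b w k)"

lemma links_append: "links M A i u k \<Longrightarrow> links M A k w l \<Longrightarrow> links M A i (u @ w) l"
  by (induction u arbitrary: i) auto

lemma links_set: "links M A i w k \<Longrightarrow> set w \<subseteq> {..<M}"
  by (induction w arbitrary: i) auto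

lemma links_iff_nth:
  assumes "k < M" "w \<noteq> []"
  shows "links M A i w k \<longleftrightarrow> set w \<subseteq> {..<M} \<and> hd w = i \<and>
     (\<forall>n. Suc n < length w \<longrightarrow> A $$ (w ! n, w ! Suc n) = 1) \<and> A $$ (last w, k) = 1"
  using assms(2)
proof (induction w arbitrary: i)
  case (Cons a w)
  note IH = Cons.IH
  show ?case
  proof (cases w)
    case Nil
    then show ?thesis using assms(1) by auto
  next
    case (Cons c w')
    have split: "(\<forall>n. Suc n < length (a # w) \<longrightarrow> A $$ ((a # w) ! n, (a # w) ! Suc n) = 1) \<longleftrightarrow>
        A $$ (a, c) = 1 \<and> (\<forall>n. Suc n < length w \<longrightarrow> A $$ (w ! n, w ! Suc n) = 1)"
      (is "(\<forall>n. ?P n) \<longleftrightarrow> _")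
    proof -
      have "(\<forall>n. ?P n) \<longleftrightarrow> ?P 0 \<and> (\<forall>n. ?P (Suc n))"
        by (rule iffI) (blast, metis not0_implies_Suc)
      then show ?thesis by (simp add: Cons)
    qed
    let ?R = "(\<forall>n. Suc n < length w \<longrightarrow> A $$ (w ! n, w ! Suc n) = 1) \<and> A $$ (last w, k) = 1"
    have "links M A b w k \<longleftrightarrow> set w \<subseteq> {..<M} \<and> c = b \<and> ?R" for b
      using IH[of b] Cons by simp
    then have "links M A i (a # w) k \<longleftrightarrow> a = i \<and> i < M \<and> A $$ (i, c) = 1 \<and> set w \<subseteq> {..<M} \<and> ?R"
      using Cons by auto
    moreover have "last (a # w) = last w" "hd (a # w) = a" "set (a # w) \<subseteq> {..<M} \<longleftrightarrow> a < M \<and> set w \<subseteq> {..<M}"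
      using Cons by auto
    ultimately show ?thesis
      unfolding split by (simp only:) blast
  qed
qed simp

lemma return_words_eq: "j < M \<Longrightarrow> return_words M A j = {w. w \<noteq> [] \<and> links M A j w j}"
  unfolding return_words_def using links_iff_nth[of j M _ A j] by blast

lemma mat_mult_nat_pos:
  fixes B C :: "nat mat"
  assumes "B \<in> carrier_mat M M" "C \<in> carrier_mat M M" "i < M" "k < M" "(B * C) $$ (i, k) > 0"
  obtains l where "l < M" "B $$ (i, l) > 0" "C $$ (l, k) > 0"
proof -
  have "(B * C) $$ (i, k) = (\<Sum>l<M. B $$ (i, l) * C $$ (l, k))"
    using assms(1-4) by (auto simp: scalar_prod_def atLeast0LessThan intro!: sum.cong)
  with assms(5) have "(\<Sum>l<M. B $$ (i, l) * C $$ (l, k)) \<noteq> 0" by linarith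
  then obtain l where "l < M" "B $$ (i, l) * C $$ (l, k) \<noteq> 0"
    by (meson sum.neutral lessThan_iff)
  then show ?thesis by (intro that[of l]) auto
qed

lemma links_of_matrix_power_pos:
  assumes A: "transition_matrix M A" and "i < M" "k < M" "(A ^\<^sub>m n) $$ (i, k) > 0"
  shows "\<exists>w. length w = n \<and> links M A i w k"
  using assms(3,4)
proof (induction n arbitrary: k)
  case 0
  then show ?case using A \<open>i < M\<close> by (auto simp: transition_matrix_def split: if_splits)
next
  case (Suc n)
  have car: "A \<in> carrier_mat M M" "A ^\<^sub>m n \<in> carrier_mat M M"
    using A by (auto simp: transition_matrix_def)
  obtain l where l: "l < M" "(A ^\<^sub>m n) $$ (i, l) > 0" "A $$ (l, k) > 0"
    using mat_mult_nat_pos[OF car(2,1) \<open>i < M\<close> \<open>k < M\<close>] Suc.prems by auto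
  then have "A $$ (l, k) = 1"
    using A \<open>k < M\<close> unfolding transition_matrix_def by fastforce
  then have "links M A l [l] k" using l \<open>k < M\<close> by auto
  moreover obtain w where "length w = n" "links M A i w l" using Suc.IH l by blast
  ultimately show ?case using links_append by (intro exI[of _ "w @ [l]"]) auto
qed

section \<open>Compositions of similarities along words\<close>

lemma norm_orthogonal_mult:
  fixes Q :: "real^'d^'d"
  assumes "orthogonal_matrix Q"
  shows "norm (Q *v x) = norm x"
  using assms orthogonal_transformation_norm[of "(*v) Q" x]
  by (simp add: orthogonal_transformation_matrix)

lemma dist_similarity:
  assumes "orthogonal_matrix Q" "0 \<le> c"
  shows "dist (similarity c Q u x) (similarity c Q u y) = c * dist x y"
  using assms by (simp add: similarity_def dist_norm norm_orthogonal_mult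
      flip: scaleR_diff_right matrix_vector_mult_diff_distrib)

lemma continuous_similarity: "continuous_on X (similarity c Q u)"
  unfolding similarity_def[abs_def]
  by (intro continuous_intros linear_continuous_on matrix_vector_mul_bounded_linear)

lemma similarity_compose:
  "similarity c P u (similarity c' Q u' x) = similarity (c * c') (P ** Q) (similarity c P u u') x"
  by (simp add: similarity_def matrix_vector_right_distrib matrix_vector_mult_scaleR
      matrix_vector_mul_assoc scaleR_add_right)

lemma word_product_append: "word_product T (u @ w) = word_product T u ** word_product T w"
  by (induction u) (auto simp: word_product_def matrix_mul_assoc)

locale irreducible_similarity_system =
  fixes M :: nat and A :: "nat mat"
    and r :: "nat \<Rightarrow> real" and T :: "nat \<Rightarrow> real^'d^'d" and v :: "nat \<Rightarrow> real^'d"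
  assumes transition: "transition_matrix M A"
    and irreducible: "irreducible_subshift M A"
    and contracting: "contracting_similarities {..<M} r T v"
begin

definition S :: "nat \<Rightarrow> real^'d \<Rightarrow> real^'d" where
  "S i = similarity (r i) (T i) (v i)"

definition F :: "nat \<Rightarrow> (real^'d) set" where
  "F i = subshift_cylinder_set M A S i"

definition ratio :: "nat list \<Rightarrow> real" where
  "ratio w = prod_list (map r w)"

text \<open>The inserted \<open>1/2\<close> makes the two bounds meaningful for an empty alphabet and keeps them strictly
  between \<open>0\<close> and \<open>1\<close>.\<close>

definition r_max :: real where
  "r_max = Max (insert (1/2) (r ` {..<M}))"

definition r_min :: real where
  "r_min = Min (insert (1/2) (r ` {..<M}))"

text \<open>The radius is chosen so that every \<open>S i\<close> maps the ball about the origin into itself: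
  \<open>r_max * radius + norm (v i) \<le> radius\<close>. The inserted \<open>1\<close> makes it positive.\<close>

definition radius :: real where
  "radius = Max (insert 1 ((\<lambda>i. norm (v i)) ` {..<M})) / (1 - r_max)"

lemma letter: "i < M \<Longrightarrow> 0 < r i" "i < M \<Longrightarrow> r i < 1" "i < M \<Longrightarrow> orthogonal_matrix (T i)"
  using contracting by (auto simp: contracting_similarities_def)

lemma r_max: "0 < r_max" "r_max < 1" "i < M \<Longrightarrow> r i \<le> r_max"
proof -
  have "1/2 \<le> r_max" unfolding r_max_def by (intro Max_ge) auto
  then show "0 < r_max" by simp
  show "r_max < 1" unfolding r_max_def using letter by (subst Max_less_iff) auto
  show "i < M \<Longrightarrow> r i \<le> r_max" unfolding r_max_def by (intro Max_ge) auto
qed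

lemma r_min: "0 < r_min" "r_min < 1" "i < M \<Longrightarrow> r_min \<le> r i"
proof -
  have "r_min \<le> 1/2" unfolding r_min_def by (intro Min_le) auto
  then show "r_min < 1" by simp
  show "0 < r_min" unfolding r_min_def using letter by (subst Min_gr_iff) auto
  show "i < M \<Longrightarrow> r_min \<le> r i" unfolding r_min_def by (intro Min_le) auto
qed

lemma radius_pos: "0 < radius"
proof -
  have "1 \<le> Max (insert 1 ((\<lambda>i. norm (v i)) ` {..<M}))" by (intro Max_ge) auto
  then have "0 < Max (insert 1 ((\<lambda>i. norm (v i)) ` {..<M}))" by linarith
  then show ?thesis unfolding radius_def using r_max by (intro divide_pos_pos) auto
qed

lemma norm_S_le:
  assumes "i < M" "norm x \<le> radius"
  shows "norm (S i x) \<le> radius"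
proof -
  let ?V = "Max (insert 1 ((\<lambda>i. norm (v i)) ` {..<M}))"
  have "norm (S i x) \<le> r i * norm x + norm (v i)"
    using norm_triangle_ineq[of "r i *\<^sub>R (T i *v x)" "v i"] letter[OF assms(1)]
    by (simp add: S_def similarity_def norm_orthogonal_mult)
  also have "\<dots> \<le> r_max * radius + ?V"
  proof (rule add_mono)
    show "r i * norm x \<le> r_max * radius"
      using assms letter[OF assms(1)] r_max radius_pos by (intro mult_mono) auto
    show "norm (v i) \<le> ?V" using assms(1) by (intro Max_ge) auto
  qed
  also have "\<dots> = radius"
    using r_max by (simp add: radius_def field_simps)
  finally show ?thesis .
qed

lemma norm_word_le: "set w \<subseteq> {..<M} \<Longrightarrow> norm x \<le> radius \<Longrightarrow> norm (foldr S w x) \<le> radius"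
  by (induction w) (auto intro: norm_S_le)

lemma ratio_simps [simp]: "ratio [] = 1" "ratio (a # w) = r a * ratio w" "ratio (u @ w) = ratio u * ratio w"
  by (auto simp: ratio_def)

lemma ratio_bounds:
  assumes "set w \<subseteq> {..<M}"
  shows "0 < ratio w" "ratio w \<le> r_max ^ length w"
proof -
  have pos: "0 < ratio w" if "set w \<subseteq> {..<M}" for w
    using that by (induction w) (auto intro!: mult_pos_pos letter)
  show "0 < ratio w" using assms by (rule pos)
  show "ratio w \<le> r_max ^ length w"
    using assms
  proof (induction w)
    case (Cons a w)
    then show ?case using letter[of a] r_max pos[of w] by (auto intro!: mult_mono simp: less_imp_le)
  qed simp
qed

lemma dist_word:
  assumes "set w \<subseteq> {..<M}"
  shows "dist (foldr S w x) (foldr S w y) = ratio w * dist x y"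
  using assms by (induction w) (auto simp: S_def dist_similarity letter less_imp_le)

lemma orthogonal_word_product: "set w \<subseteq> {..<M} \<Longrightarrow> orthogonal_matrix (word_product T w)"
  by (induction w) (auto simp: word_product_def orthogonal_matrix_id orthogonal_matrix_mul letter)

lemma word_similarity:
  "foldr S w x = similarity (ratio w) (word_product T w) (foldr S w 0) x"
proof (induction w)
  case Nil
  then show ?case by (simp add: similarity_def word_product_def)
next
  case (Cons a w)
  have "foldr S (a # w) x = S a (similarity (ratio w) (word_product T w) (foldr S w 0) x)"
    using Cons by simp
  also have "\<dots> = similarity (ratio (a # w)) (word_product T (a # w)) (foldr S (a # w) 0) x"
    by (simp add: S_def[of a] similarity_compose word_product_def)
  finally show ?case .
qed

section \<open>The coding map\<close>

lemma dist_prefixes: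
  assumes "\<And>i. \<alpha> i < M" "k \<le> l"
  shows "dist (foldr S (map \<alpha> [0..<k]) 0) (foldr S (map \<alpha> [0..<l]) 0) \<le> r_max ^ k * radius"
proof -
  let ?x = "foldr S (map \<alpha> [k..<l]) 0"
  have sub: "set (map \<alpha> [m..<n]) \<subseteq> {..<M}" for m n using assms(1) by auto
  have "[0..<l] = [0..<k] @ [k..<l]"
    using assms(2) by (metis le0 upt_add_eq_append le_add_diff_inverse)
  then have "foldr S (map \<alpha> [0..<l]) 0 = foldr S (map \<alpha> [0..<k]) ?x" by simp
  then have "dist (foldr S (map \<alpha> [0..<k]) 0) (foldr S (map \<alpha> [0..<l]) 0) = ratio (map \<alpha> [0..<k]) * norm ?x"
    using dist_word[OF sub, of 0 k 0 ?x] by simp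
  also have "\<dots> \<le> r_max ^ k * radius"
    using ratio_bounds[OF sub, of 0 k] norm_word_le[OF sub, of 0 k l] radius_pos r_max
    by (intro mult_mono) auto
  finally show ?thesis .
qed

lemma r_max_power_tendsto_0: "(\<lambda>k. r_max ^ k * radius) \<longlonglongrightarrow> 0"
  using tendsto_mult_left_zero[OF LIMSEQ_power_zero[of r_max], of radius] r_max by auto

lemma coding_tendsto:
  assumes "\<And>i. \<alpha> i < M"
  shows "(\<lambda>k. foldr S (map \<alpha> [0..<k]) 0) \<longlonglongrightarrow> coding_map S \<alpha>"
proof -
  have "Cauchy (\<lambda>k. foldr S (map \<alpha> [0..<k]) 0)"
  proof (rule metric_CauchyI)
    fix e :: real assume "0 < e"
    then have "\<forall>\<^sub>F k in sequentially. r_max ^ k * radius < e / 2"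
      using order_tendstoD(2)[OF r_max_power_tendsto_0, of "e/2"] by simp
    then obtain N where N: "r_max ^ N * radius < e / 2"
      using eventually_happens'[OF sequentially_bot] by blast
    show "\<exists>N. \<forall>m\<ge>N. \<forall>n\<ge>N. dist (foldr S (map \<alpha> [0..<m]) 0) (foldr S (map \<alpha> [0..<n]) 0) < e"
    proof (intro exI[of _ N] allI impI)
      fix m n assume "N \<le> m" "N \<le> n"
      then have "dist (foldr S (map \<alpha> [0..<N]) 0) (foldr S (map \<alpha> [0..<m]) 0) < e / 2"
        "dist (foldr S (map \<alpha> [0..<N]) 0) (foldr S (map \<alpha> [0..<n]) 0) < e / 2"
        using dist_prefixes[OF assms] N by (meson le_less_trans)+
      then show "dist (foldr S (map \<alpha> [0..<m]) 0) (foldr S (map \<alpha> [0..<n]) 0) < e"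
        by (rule dist_triangle_half_r)
    qed
  qed
  then have "convergent (\<lambda>k. foldr S (map \<alpha> [0..<k]) 0)"
    by (rule Cauchy_convergent)
  then show ?thesis
    unfolding coding_map_def by (simp add: convergent_LIMSEQ_iff)
qed

lemma dist_prefix_coding:
  assumes "\<And>i. \<alpha> i < M"
  shows "dist (foldr S (map \<alpha> [0..<k]) 0) (coding_map S \<alpha>) \<le> r_max ^ k * radius"
proof (rule Lim_bounded)
  show "(\<lambda>l. dist (foldr S (map \<alpha> [0..<k]) 0) (foldr S (map \<alpha> [0..<l]) 0)) \<longlonglongrightarrow>
      dist (foldr S (map \<alpha> [0..<k]) 0) (coding_map S \<alpha>)"
    by (intro tendsto_intros coding_tendsto assms)
qed (use dist_prefixes assms in blast)

lemma coding_shift: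
  assumes "\<And>i. \<alpha> i < M"
  shows "coding_map S \<alpha> = S (\<alpha> 0) (coding_map S (\<lambda>i. \<alpha> (Suc i)))"
proof (rule LIMSEQ_unique)
  show "(\<lambda>k. foldr S (map \<alpha> [0..<Suc k]) 0) \<longlonglongrightarrow> coding_map S \<alpha>"
    using coding_tendsto[OF assms] by (rule LIMSEQ_Suc)
  have cont: "isCont (S (\<alpha> 0)) x" for x
    using continuous_similarity[of UNIV "r (\<alpha> 0)" "T (\<alpha> 0)" "v (\<alpha> 0)"]
    by (simp add: S_def continuous_on_eq_continuous_at)
  have "(\<lambda>k. S (\<alpha> 0) (foldr S (map (\<lambda>i. \<alpha> (Suc i)) [0..<k]) 0)) \<longlonglongrightarrow>
      S (\<alpha> 0) (coding_map S (\<lambda>i. \<alpha> (Suc i)))"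
    by (rule isCont_tendsto_compose[OF cont coding_tendsto]) (rule assms)
  then show "(\<lambda>k. foldr S (map \<alpha> [0..<Suc k]) 0) \<longlonglongrightarrow> S (\<alpha> 0) (coding_map S (\<lambda>i. \<alpha> (Suc i)))"
    by (simp only: map_upt_Suc foldr.simps o_apply)
qed

text \<open>Splitting off the first letter of a coding sequence gives the graph-directed equations of the sets
  \<open>F i\<close>; iterated, they replace infinite sequences by finite words.\<close>

lemma F_step:
  assumes "i < M"
  shows "F i = (\<Union>k\<in>{k. k < M \<and> A $$ (i, k) = 1}. S i ` F k)"
proof (intro equalityI subsetI)
  fix x assume "x \<in> F i"
  then obtain \<alpha> where \<alpha>: "\<And>n. \<alpha> n < M" "\<And>n. A $$ (\<alpha> n, \<alpha> (Suc n)) = 1" "\<alpha> 0 = i" "x = coding_map S \<alpha>"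
    by (auto simp: F_def subshift_cylinder_set_def subshift_def)
  then have "x = S i (coding_map S (\<lambda>n. \<alpha> (Suc n)))" using coding_shift by metis
  moreover have "coding_map S (\<lambda>n. \<alpha> (Suc n)) \<in> F (\<alpha> (Suc 0))"
    using \<alpha> by (auto simp: F_def subshift_cylinder_set_def subshift_def)
  moreover have "A $$ (i, \<alpha> (Suc 0)) = 1" using \<alpha>(2)[of 0] \<alpha>(3) by simp
  ultimately show "x \<in> (\<Union>k\<in>{k. k < M \<and> A $$ (i, k) = 1}. S i ` F k)" using \<alpha>(1) by blast
next
  fix x assume "x \<in> (\<Union>k\<in>{k. k < M \<and> A $$ (i, k) = 1}. S i ` F k)"
  then obtain k y where k: "A $$ (i, k) = 1" "y \<in> F k" "x = S i y" by auto
  then obtain \<alpha> where \<alpha>: "\<And>n. \<alpha> n < M" "\<And>n. A $$ (\<alpha> n, \<alpha> (Suc n)) = 1" "\<alpha> 0 = k" "y = coding_map S \<alpha>"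
    by (auto simp: F_def subshift_cylinder_set_def subshift_def)
  have lt: "case_nat i \<alpha> n < M" for n using \<alpha>(1) assms by (auto split: nat.split)
  have "coding_map S (case_nat i \<alpha>) = x"
    using coding_shift[OF lt] by (simp add: k \<alpha>)
  moreover have "case_nat i \<alpha> \<in> {\<alpha> \<in> subshift M A. \<alpha> 0 = i}"
    using lt \<alpha> k(1) by (auto simp: subshift_def split: nat.split)
  ultimately show "x \<in> F i" unfolding F_def subshift_cylinder_set_def by blast
qed

lemma F_word: "links M A i w k \<Longrightarrow> i < M \<Longrightarrow> foldr S w ` F k \<subseteq> F i"
proof (induction w arbitrary: i)
  case (Cons a w)
  from Cons.prems(1) obtain b where b: "a = i" "b < M" "A $$ (i, b) = 1" "links M A b w k" by auto
  have "foldr S w ` F k \<subseteq> F b" by (rule Cons.IH[OF b(4,2)])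
  moreover have "S i ` F b \<subseteq> F i" using F_step[OF Cons.prems(2)] b by blast
  ultimately show ?case using b(1) by (auto simp: image_subset_iff)
qed simp

lemma norm_F_le:
  assumes "x \<in> F i"
  shows "norm x \<le> radius"
proof -
  obtain \<alpha> where \<alpha>: "\<And>n. \<alpha> n < M" "x = coding_map S \<alpha>"
    using assms by (auto simp: F_def subshift_cylinder_set_def subshift_def)
  then show ?thesis using dist_prefix_coding[of \<alpha> 0] by simp
qed

lemma dist_F_le: "x \<in> F i \<Longrightarrow> y \<in> F k \<Longrightarrow> dist x y \<le> 2 * radius"
  using norm_F_le[of x i] norm_F_le[of y k] norm_triangle_ineq4[of x y] by (simp add: dist_norm)

lemma connecting_word:
  assumes "i < M" "k < M"
  shows "\<exists>w. w \<noteq> [] \<and> links M A i w k"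
proof -
  obtain n where n: "0 < n" "(A ^\<^sub>m n) $$ (i, k) > 0"
    using irreducible assms by (auto simp: irreducible_subshift_def)
  obtain w where "length w = n" "links M A i w k"
    using links_of_matrix_power_pos[OF transition assms n(2)] by blast
  with n(1) show ?thesis by auto
qed

lemma F_nonempty:
  assumes "i < M"
  shows "F i \<noteq> {}"
proof -
  have "\<exists>b<M. A $$ (a, b) = 1" if a: "a < M" for a
  proof -
    obtain w where "w \<noteq> []" "links M A a w a" using connecting_word[OF a a] by blast
    then show ?thesis by (cases w) auto
  qed
  then obtain s where s: "\<And>a. a < M \<Longrightarrow> s a < M \<and> A $$ (a, s a) = 1" by metis
  have "(s ^^ n) i < M" for n using s assms by (induction n) auto
  then have "(\<lambda>n. (s ^^ n) i) \<in> {\<alpha> \<in> subshift M A. \<alpha> 0 = i}"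
    using s by (auto simp: subshift_def)
  then show ?thesis by (auto simp: F_def subshift_cylinder_set_def)
qed

lemma open_coordinate: "open {\<alpha> :: nat \<Rightarrow> nat. P (\<alpha> n)}"
proof -
  have "open ((\<lambda>\<alpha> :: nat \<Rightarrow> nat. \<alpha> n) -` {a. P a})"
    by (rule open_vimage[OF open_discrete]) simp
  then show ?thesis by (simp add: vimage_def)
qed

lemma compact_subshift_cylinder: "compact {\<alpha> \<in> subshift M A. \<alpha> 0 = i}"
proof -
  have "compactin (product_topology (\<lambda>_. euclidean) UNIV) (PiE UNIV (\<lambda>_ :: nat. {..<M}))"
    by (subst compactin_PiE) (auto simp: finite_imp_compact)
  then have "compact (PiE UNIV (\<lambda>_ :: nat. {..<M}))"
    by (simp add: euclidean_product_topology)
  moreover have "closed {\<alpha> :: nat \<Rightarrow> nat. A $$ (\<alpha> n, \<alpha> (Suc n)) = 1}" for n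
  proof -
    have eq: "{\<alpha> :: nat \<Rightarrow> nat. A $$ (\<alpha> n, \<alpha> (Suc n)) = 1} =
        - (\<Union>a. {\<alpha>. \<alpha> n = a} \<inter> {\<alpha>. A $$ (a, \<alpha> (Suc n)) \<noteq> 1})"
      by auto
    show ?thesis
      unfolding eq by (intro closed_Compl open_UN ballI open_Int open_coordinate)
  qed
  moreover have "closed {\<alpha> :: nat \<Rightarrow> nat. \<alpha> 0 = i}"
    using open_coordinate[of "\<lambda>a. a \<noteq> i" 0] by (simp add: closed_def Compl_eq)
  ultimately have "compact (PiE UNIV (\<lambda>_ :: nat. {..<M}) \<inter>
      ((\<Inter>n. {\<alpha>. A $$ (\<alpha> n, \<alpha> (Suc n)) = 1}) \<inter> {\<alpha>. \<alpha> 0 = i}))"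
    by (intro compact_Int_closed closed_Int closed_INT) auto
  also have "\<dots> = {\<alpha> \<in> subshift M A. \<alpha> 0 = i}"
    by (auto simp: subshift_def PiE_def)
  finally show ?thesis .
qed

lemma continuous_prefix:
  fixes g :: "nat list \<Rightarrow> 'b::topological_space"
  shows "continuous_on UNIV (\<lambda>\<alpha> :: nat \<Rightarrow> nat. g (map \<alpha> [0..<k]))"
proof -
  have "((\<lambda>\<beta>. g (map \<beta> [0..<k])) \<longlongrightarrow> g (map \<alpha> [0..<k])) (at \<alpha>)" for \<alpha> :: "nat \<Rightarrow> nat"
  proof (rule tendsto_eventually)
    have "open (\<Inter>n<k. {\<beta> :: nat \<Rightarrow> nat. \<beta> n = \<alpha> n})"
      by (intro open_INT ballI open_coordinate) auto
    moreover have "g (map \<beta> [0..<k]) = g (map \<alpha> [0..<k])" if "\<beta> \<in> (\<Inter>n<k. {\<beta>. \<beta> n = \<alpha> n})" for \<beta>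
    proof -
      have "map \<beta> [0..<k] = map \<alpha> [0..<k]" using that by auto
      then show ?thesis by (rule arg_cong)
    qed
    moreover have "\<alpha> \<in> (\<Inter>n<k. {\<beta>. \<beta> n = \<alpha> n})" by simp
    ultimately show "\<forall>\<^sub>F \<beta> in at \<alpha>. g (map \<beta> [0..<k]) = g (map \<alpha> [0..<k])"
      unfolding eventually_at_topological by blast
  qed
  then show ?thesis by (simp add: continuous_on_def)
qed

text \<open>The coding map is a uniform limit of functions that depend on finitely many letters.\<close>

lemma compact_F: "compact (F i)"
proof -
  let ?C = "{\<alpha> \<in> subshift M A. \<alpha> 0 = i}"
  have "uniform_limit ?C (\<lambda>k \<alpha>. foldr S (map \<alpha> [0..<k]) 0) (coding_map S) sequentially"
  proof (rule uniform_limitI)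
    fix e :: real assume "0 < e"
    then have "\<forall>\<^sub>F k in sequentially. r_max ^ k * radius < e"
      using order_tendstoD(2)[OF r_max_power_tendsto_0] by blast
    then show "\<forall>\<^sub>F k in sequentially. \<forall>\<alpha>\<in>?C. dist (foldr S (map \<alpha> [0..<k]) 0) (coding_map S \<alpha>) < e"
    proof eventually_elim
      case (elim k)
      then show ?case
        using dist_prefix_coding by (auto simp: subshift_def intro: le_less_trans)
    qed
  qed
  moreover have "continuous_on ?C (\<lambda>\<alpha>. foldr S (map \<alpha> [0..<k]) 0)" for k
    using continuous_prefix[of "\<lambda>w. foldr S w 0" k] by (rule continuous_on_subset) simp
  ultimately have "continuous_on ?C (coding_map S)"
    by (intro uniform_limit_theorem[where F = sequentially]) auto
  then show ?thesis
    unfolding F_def subshift_cylinder_set_def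
    by (intro compact_continuous_image compact_subshift_cylinder)
qed

section \<open>Words of prescribed size\<close>

text \<open>Read a coding sequence of \<open>x\<close> until the ratio is first at most \<open>\<delta>\<close>; the last letter costs a
  factor of at least \<open>r_min\<close>. The bound \<open>r_max ^ n \<le> \<delta>\<close> guarantees that this happens within \<open>n\<close> letters.\<close>

lemma stopping_word:
  assumes "r_max ^ n \<le> \<delta>" "0 < \<delta>" "\<delta> \<le> 1" "i < M" "x \<in> F i"
  shows "\<exists>w k. k < M \<and> links M A i w k \<and> x \<in> foldr S w ` F k \<and> ratio w \<le> \<delta> \<and> r_min * \<delta> \<le> ratio w"
  using assms
proof (induction n arbitrary: \<delta> i x)
  case 0
  then have "\<delta> = 1" by simp
  then show ?case using 0 r_min by (intro exI[of _ "[]"] exI[of _ i]) auto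
next
  case (Suc n)
  obtain b y where b: "b < M" "A $$ (i, b) = 1" "y \<in> F b" "x = S i y"
    using F_step[OF \<open>i < M\<close>] \<open>x \<in> F i\<close> by auto
  note ri = letter[OF \<open>i < M\<close>]
  show ?case
  proof (cases "\<delta> \<le> r i")
    case True
    have "r i * r_max ^ n \<le> r_max * r_max ^ n"
      using r_max(1) r_max(3)[OF \<open>i < M\<close>] by (intro mult_right_mono) auto
    then have "r i * r_max ^ n \<le> \<delta>"
      using Suc.prems(1) by simp
    then have "r_max ^ n \<le> \<delta> / r i" using ri by (simp add: field_simps)
    moreover have "0 < \<delta> / r i" "\<delta> / r i \<le> 1" using True ri Suc.prems by (auto simp: field_simps)
    ultimately obtain w k where w: "k < M" "links M A b w k" "y \<in> foldr S w ` F k"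
      "ratio w \<le> \<delta> / r i" "r_min * (\<delta> / r i) \<le> ratio w"
      using Suc.IH[OF _ _ _ b(1,3)] by blast
    then show ?thesis
      using b ri \<open>i < M\<close> by (intro exI[of _ "i # w"] exI[of _ k]) (auto simp: field_simps)
  next
    case False
    have "r_min * \<delta> \<le> r i * 1"
      using r_min r_min(3)[OF \<open>i < M\<close>] Suc.prems ri by (intro mult_mono) auto
    then show ?thesis
      using b False \<open>i < M\<close> by (intro exI[of _ "[i]"] exI[of _ b]) auto
  qed
qed

end

section \<open>Counting separated points\<close>

text \<open>The Hausdorff dimension is at most the lower box dimension: covers at arbitrarily small scales
  \<open>exp (- x)\<close> suffice, not at all of them.\<close>

lemma hausdorff_dim_le_of_frequent_covers:
  fixes E :: "'a::euclidean_space set"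
  assumes "0 \<le> t" "0 < C"
    and cov: "\<exists>\<^sub>F x in at_top. \<exists>\<U>. finite \<U> \<and> E \<subseteq> \<Union>\<U> \<and>
           (\<forall>U\<in>\<U>. bounded U \<and> diameter U \<le> C * exp (- x)) \<and> real (card \<U>) \<le> C * exp (t * x)"
  shows "hausdorff_dim E \<le> t"
proof (rule dense_ge)
  fix s assume s: "t < s"
  have "hausdorff_measure s E = 0"
  proof (rule hausdorff_measure_eq_0I)
    show "0 < s" using s assms(1) by simp
    fix e :: real assume e: "0 < e"
    have "((\<lambda>x. C * exp (- x)) \<longlongrightarrow> 0) at_top" by real_asymp
    then have ev1: "\<forall>\<^sub>F x in at_top. C * exp (- x) < e" using e by (rule order_tendstoD)
    define a where "a = s - t"
    have "0 < a" using s by (simp add: a_def)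
    then have "((\<lambda>x. C * C powr s * exp (- (a * x))) \<longlongrightarrow> 0) at_top" by real_asymp
    then have ev2: "\<forall>\<^sub>F x in at_top. C * C powr s * exp (- (a * x)) < e" using e by (rule order_tendstoD)
    have "\<exists>\<^sub>F x in at_top. (\<exists>\<U>. finite \<U> \<and> E \<subseteq> \<Union>\<U> \<and>
           (\<forall>U\<in>\<U>. bounded U \<and> diameter U \<le> C * exp (- x)) \<and> real (card \<U>) \<le> C * exp (t * x)) \<and>
           C * exp (- x) < e \<and> C * C powr s * exp (- (a * x)) < e"
      using frequently_eventually_frequently[OF cov eventually_conj[OF ev1 ev2]] by simp
    from frequently_ex[OF this] obtain x \<U> where U: "finite \<U>" "E \<subseteq> \<Union>\<U>" "\<forall>U\<in>\<U>. bounded U \<and> diameter U \<le> C * exp (- x)"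
      "real (card \<U>) \<le> C * exp (t * x)" "C * exp (- x) < e" "C * C powr s * exp (- (a * x)) < e"
      by blast
    have "real (card \<U>) * (C * exp (- x)) powr s \<le> C * exp (t * x) * (C * exp (- x)) powr s"
      using U(4) by (intro mult_right_mono) auto
    also have "\<dots> = C * C powr s * exp (- (a * x))"
      using assms(2) by (simp add: powr_mult exp_powr_real a_def algebra_simps flip: exp_add)
    finally show "\<exists>\<U> d. finite \<U> \<and> E \<subseteq> \<Union>\<U> \<and> (\<forall>U\<in>\<U>. bounded U \<and> diameter U \<le> d) \<and>
           d \<le> e \<and> real (card \<U>) * d powr s \<le> e"
      using U by (intro exI[of _ \<U>] exI[of _ "C * exp (- x)"]) auto
  qed
  then show "hausdorff_dim E \<le> s"
    using s assms(1) by (intro hausdorff_dim_le) auto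
qed

text \<open>Separated sets have at most as many points as a cover by balls of half the radius, so that one
  of maximal cardinality exists; by maximality it is a net.\<close>

lemma maximal_separated_subset:
  fixes X :: "'a::metric_space set"
  assumes "compact X" "0 < \<delta>"
  shows "\<exists>P. finite P \<and> P \<subseteq> X \<and> (\<forall>p\<in>P. \<forall>q\<in>P. p \<noteq> q \<longrightarrow> \<delta> < dist p q) \<and> X \<subseteq> (\<Union>p\<in>P. cball p \<delta>)"
proof -
  obtain C where C: "finite C" "X \<subseteq> (\<Union>c\<in>C. ball c (\<delta>/2))"
    using assms unfolding compact_eq_totally_bounded by (meson half_gt_zero)
  define sep where "sep P \<longleftrightarrow> P \<subseteq> X \<and> (\<forall>p\<in>P. \<forall>q\<in>P. p \<noteq> q \<longrightarrow> \<delta> < dist p q)" for P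
  have card_le: "finite P \<and> card P \<le> card C" if P: "sep P" for P
  proof -
    have "P \<subseteq> (\<Union>c\<in>C. ball c (\<delta>/2))" using P C(2) unfolding sep_def by (metis subset_trans)
    then have "\<forall>p\<in>P. \<exists>c. c \<in> C \<and> p \<in> ball c (\<delta>/2)" by blast
    from bchoice[OF this] obtain c where c: "\<forall>p\<in>P. c p \<in> C \<and> p \<in> ball (c p) (\<delta>/2)" ..
    have "inj_on c P"
    proof (rule inj_onI, rule ccontr)
      fix p q assume pq: "p \<in> P" "q \<in> P" "c p = c q" "p \<noteq> q"
      then have "dist (c p) p < \<delta> / 2" "dist (c p) q < \<delta> / 2"
        using bspec[OF c pq(1)] bspec[OF c pq(2)] by (simp_all add: pq(3))
      then have "dist p q < \<delta>" by (rule dist_triangle_half_r)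
      moreover have "\<delta> < dist p q" using P pq(1,2,4) by (simp add: sep_def)
      ultimately show False by simp
    qed
    moreover have "c ` P \<subseteq> C" using c by auto
    ultimately show ?thesis using C(1) by (metis card_inj_on_le inj_on_finite)
  qed
  have "sep {}" by (simp add: sep_def)
  then obtain P where P: "sep P" "\<And>P'. sep P' \<Longrightarrow> card P' \<le> card P"
    using ex_has_greatest_nat[of sep "{}" card "card C + 1"] card_le by (metis less_Suc_eq_le Suc_eq_plus1)
  have "X \<subseteq> (\<Union>p\<in>P. cball p \<delta>)"
  proof (rule ccontr)
    assume "\<not> X \<subseteq> (\<Union>p\<in>P. cball p \<delta>)"
    then obtain x where "x \<in> X" "x \<notin> (\<Union>p\<in>P. cball p \<delta>)" by blast
    then have x: "x \<in> X" "\<And>p. p \<in> P \<Longrightarrow> \<delta> < dist p x" by (simp_all add: not_le)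
    then have "x \<notin> P" using assms(2) by fastforce
    moreover have "sep (insert x P)" using P(1) x by (auto simp: sep_def dist_commute)
    ultimately show False using P(2)[of "insert x P"] card_le[OF P(1)] by auto
  qed
  then show ?thesis using P(1) card_le[OF P(1)] by (auto simp: sep_def)
qed

context irreducible_similarity_system
begin

lemma subshift_set_eq: "subshift_set M A S = (\<Union>i<M. F i)"
  by (auto simp: subshift_set_def F_def subshift_cylinder_set_def subshift_def)

text \<open>A cover of the single set \<open>F j\<close> yields one of the whole set, because \<open>F j\<close> contains a
  similar copy of every \<open>F i\<close>.\<close>

lemma covering_number_F_ge:
  assumes j: "j < M" and t: "0 \<le> t" "t < hausdorff_dim (subshift_set M A S)" and c: "0 < c"
  shows "\<forall>\<^sub>F x in at_top. \<forall>P. finite P \<longrightarrow> F j \<subseteq> (\<Union>p\<in>P. cball p (c * exp (- x))) \<longrightarrow> exp (t * x) < real (card P)"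
proof (rule ccontr)
  assume "\<not> ?thesis"
  then have freq: "\<exists>\<^sub>F x in at_top. \<exists>P. finite P \<and> F j \<subseteq> (\<Union>p\<in>P. cball p (c * exp (- x))) \<and>
      real (card P) \<le> exp (t * x)"
    by (simp add: not_eventually not_less)
  have "\<forall>i\<in>{..<M}. \<exists>w. links M A j w i" using connecting_word[OF j] by blast
  from bchoice[OF this] obtain b where b: "\<forall>i\<in>{..<M}. links M A j (b i) i" ..
  have pos: "0 < ratio (b i)" if "i < M" for i
    using ratio_bounds(1) links_set b that by blast
  define \<kappa> where "\<kappa> = Min ((\<lambda>i. ratio (b i)) ` {..<M})"
  have ne: "{..<M} \<noteq> {}" using j by auto
  have \<kappa>: "0 < \<kappa>" unfolding \<kappa>_def using pos ne by (subst Min_gr_iff) auto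
  have \<kappa>_le: "\<kappa> \<le> ratio (b i)" if "i < M" for i unfolding \<kappa>_def using that by (intro Min_le) auto
  define C where "C = 2 * c / \<kappa> + real M"
  have C: "0 < C" "real M \<le> C" "2 * c / \<kappa> \<le> C" using c \<kappa> j by (auto simp: C_def add_pos_nonneg)
  have "hausdorff_dim (subshift_set M A S) \<le> t"
  proof (rule hausdorff_dim_le_of_frequent_covers[OF t(1) C(1)])
    show "\<exists>\<^sub>F x in at_top. \<exists>\<U>. finite \<U> \<and> subshift_set M A S \<subseteq> \<Union>\<U> \<and>
           (\<forall>U\<in>\<U>. bounded U \<and> diameter U \<le> C * exp (- x)) \<and> real (card \<U>) \<le> C * exp (t * x)"
      using freq
    proof (rule frequently_elim1)
      fix x assume "\<exists>P. finite P \<and> F j \<subseteq> (\<Union>p\<in>P. cball p (c * exp (- x))) \<and> real (card P) \<le> exp (t * x)"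
      then obtain P where P: "finite P" "F j \<subseteq> (\<Union>p\<in>P. cball p (c * exp (- x)))" "real (card P) \<le> exp (t * x)"
        by blast
      define V where "V i p = {y. foldr S (b i) y \<in> cball p (c * exp (- x))}" for i p
      let ?\<U> = "(\<lambda>(i, p). V i p) ` ({..<M} \<times> P)"
      have V: "bounded (V i p) \<and> diameter (V i p) \<le> C * exp (- x)" if i: "i < M" for i p
      proof
        have *: "dist y z \<le> C * exp (- x)" if yz: "y \<in> V i p" "z \<in> V i p" for y z
        proof -
          have "ratio (b i) * dist y z = dist (foldr S (b i) y) (foldr S (b i) z)"
            using dist_word[OF links_set] b i by fastforce
          also have "\<dots> \<le> dist (foldr S (b i) y) p + dist (foldr S (b i) z) p"
            by (rule dist_triangle2)
          also have "\<dots> \<le> 2 * c * exp (- x)"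
            using yz by (simp add: V_def dist_commute)
          finally have "\<kappa> * dist y z \<le> 2 * c * exp (- x)"
            using mult_right_mono[OF \<kappa>_le[OF i] zero_le_dist[of y z]] by linarith
          then have "dist y z \<le> 2 * c / \<kappa> * exp (- x)" using \<kappa> by (simp add: field_simps)
          also have "\<dots> \<le> C * exp (- x)" using C by (intro mult_right_mono) auto
          finally show ?thesis .
        qed
        then show "bounded (V i p)" unfolding bounded_two_points by blast
        show "diameter (V i p) \<le> C * exp (- x)"
          using * C by (intro diameter_le) (auto simp: dist_norm)
      qed
      have "subshift_set M A S \<subseteq> \<Union>?\<U>"
      proof
        fix y assume "y \<in> subshift_set M A S"
        then obtain i where i: "i < M" "y \<in> F i" by (auto simp: subshift_set_eq)
        have "links M A j (b i) i" using b i by blast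
        then have "foldr S (b i) y \<in> F j" using F_word j i(2) by blast
        then obtain p where "p \<in> P" "y \<in> V i p" using P(2) by (auto simp: V_def)
        then show "y \<in> \<Union>?\<U>" using i by auto
      qed
      moreover have "real (card ?\<U>) \<le> C * exp (t * x)"
      proof -
        have "card ?\<U> \<le> card ({..<M} \<times> P)" using P(1) by (intro card_image_le) auto
        then have "real (card ?\<U>) \<le> real M * real (card P)" by (simp add: card_cartesian_product flip: of_nat_mult)
        also have "\<dots> \<le> C * exp (t * x)" using P(3) C by (intro mult_mono) auto
        finally show ?thesis .
      qed
      ultimately show "\<exists>\<U>. finite \<U> \<and> subshift_set M A S \<subseteq> \<Union>\<U> \<and>
           (\<forall>U\<in>\<U>. bounded U \<and> diameter U \<le> C * exp (- x)) \<and> real (card \<U>) \<le> C * exp (t * x)"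
        using V P(1) by (intro exI[of _ ?\<U>]) auto
    qed
  qed
  with t show False by simp
qed

section \<open>Return words with equal ratios\<close>

lemma return_word_iff: "j < M \<Longrightarrow> w \<in> return_words M A j \<longleftrightarrow> w \<noteq> [] \<and> links M A j w j"
  by (simp add: return_words_eq)

lemma return_word_set: "j < M \<Longrightarrow> w \<in> return_words M A j \<Longrightarrow> set w \<subseteq> {..<M}"
  by (auto simp: return_words_def)

lemma return_word_append:
  "j < M \<Longrightarrow> u \<in> return_words M A j \<Longrightarrow> w \<in> return_words M A j \<Longrightarrow> u @ w \<in> return_words M A j"
  using links_append by (auto simp: return_word_iff)

lemma return_word_F: "j < M \<Longrightarrow> w \<in> return_words M A j \<Longrightarrow> foldr S w ` F j \<subseteq> F j"
  by (intro F_word) (auto simp: return_word_iff)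

lemma return_word_ratio:
  assumes "j < M" "w \<in> return_words M A j"
  shows "0 < ratio w" "ratio w < 1"
proof -
  show "0 < ratio w" using ratio_bounds(1)[OF return_word_set[OF assms]] .
  have "w \<noteq> []" using assms by (simp add: return_words_def)
  then have "r_max ^ length w \<le> r_max ^ 1"
    using r_max by (intro power_decreasing) (auto simp: Suc_le_eq)
  then show "ratio w < 1"
    using ratio_bounds(2)[OF return_word_set[OF assms]] r_max by simp
qed

text \<open>A stopping word of \<open>x\<close>, extended by one of finitely many words that lead back to \<open>j\<close>.\<close>

lemma local_return_words:
  assumes j: "j < M"
  shows "\<exists>\<kappa>>0. \<forall>\<delta> x. 0 < \<delta> \<longrightarrow> \<delta> \<le> 1 \<longrightarrow> x \<in> F j \<longrightarrow>
    (\<exists>u\<in>return_words M A j. (\<forall>y\<in>F j. dist x (foldr S u y) \<le> 2 * radius * \<delta>) \<and> \<kappa> * \<delta> \<le> ratio u)"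
proof -
  have "\<forall>k\<in>{..<M}. \<exists>w. w \<noteq> [] \<and> links M A k w j" using connecting_word j by blast
  from bchoice[OF this] obtain b where b: "\<forall>k\<in>{..<M}. b k \<noteq> [] \<and> links M A k (b k) j" ..
  have ne: "{..<M} \<noteq> {}" using j by auto
  define c where "c = Min ((\<lambda>k. ratio (b k)) ` {..<M})"
  have pos: "0 < ratio (b i)" if "i < M" for i
    using ratio_bounds(1) links_set b that by blast
  have c: "0 < c" unfolding c_def using pos ne by (subst Min_gr_iff) auto
  have c_le: "c \<le> ratio (b k)" if "k < M" for k unfolding c_def using that by (intro Min_le) auto
  have "\<exists>u\<in>return_words M A j. (\<forall>y\<in>F j. dist x (foldr S u y) \<le> 2 * radius * \<delta>) \<and> r_min * c * \<delta> \<le> ratio u"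
    if \<delta>: "0 < \<delta>" "\<delta> \<le> 1" and x: "x \<in> F j" for \<delta> x
  proof -
    have "(\<lambda>n. r_max ^ n) \<longlonglongrightarrow> 0" using r_max by (intro LIMSEQ_power_zero) auto
    then have "\<forall>\<^sub>F n in sequentially. r_max ^ n < \<delta>" using \<delta>(1) by (rule order_tendstoD)
    then obtain n where "r_max ^ n < \<delta>" using eventually_happens'[OF sequentially_bot] by blast
    then obtain w k where w: "k < M" "links M A j w k" "x \<in> foldr S w ` F k" "ratio w \<le> \<delta>" "r_min * \<delta> \<le> ratio w"
      using stopping_word[of n \<delta> j x] \<delta> j x by (meson less_imp_le)
    have bk: "b k \<noteq> []" "links M A k (b k) j" using b w(1) by auto
    show ?thesis
    proof (intro bexI[of _ "w @ b k"] conjI ballI)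
      show "w @ b k \<in> return_words M A j"
        using links_append[OF w(2) bk(2)] bk(1) j by (simp add: return_word_iff)
      show "r_min * c * \<delta> \<le> ratio (w @ b k)"
        using mult_mono[OF w(5) c_le[OF w(1)]] c r_min \<delta> ratio_bounds(1)[OF links_set[OF w(2)]]
        by (simp add: mult_ac)
      fix y assume y: "y \<in> F j"
      obtain z where z: "z \<in> F k" "x = foldr S w z" using w(3) by blast
      have "foldr S (b k) y \<in> F k" using F_word[OF bk(2) w(1)] y by blast
      then have "dist z (foldr S (b k) y) \<le> 2 * radius" by (rule dist_F_le[OF z(1)])
      then have "ratio w * dist z (foldr S (b k) y) \<le> \<delta> * (2 * radius)"
        using w(4) \<delta> by (intro mult_mono) auto
      then show "dist x (foldr S (w @ b k) y) \<le> 2 * radius * \<delta>"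
        by (simp add: z(2) dist_word[OF links_set[OF w(2)]] mult_ac)
    qed
  qed
  then show ?thesis using c r_min(1) by (intro exI[of _ "r_min * c"]) auto
qed

lemma ratio_eq_prod_count:
  "set w \<subseteq> {..<M} \<Longrightarrow> ratio w = (\<Prod>i<M. r i ^ count_list w i)"
proof (induction w)
  case (Cons a w)
  have "(\<Prod>i<M. r i ^ count_list (a # w) i) = (\<Prod>i<M. (if a = i then r i else 1) * r i ^ count_list w i)"
    by (intro prod.cong) auto
  also have "\<dots> = r a * (\<Prod>i<M. r i ^ count_list w i)"
    using Cons.prems by (simp add: prod.distrib prod.delta')
  finally show ?case using Cons by simp
qed simp

text \<open>The ratio is a function of the letter counts, each of which is at most \<open>L\<close>.\<close>

lemma card_ratios_le:
  shows "finite (ratio ` {w. set w \<subseteq> {..<M} \<and> length w \<le> L})"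
    and "card (ratio ` {w. set w \<subseteq> {..<M} \<and> length w \<le> L}) \<le> (L + 1) ^ M"
proof -
  let ?P = "PiE {..<M} (\<lambda>_. {..L})"
  have sub: "ratio ` {w. set w \<subseteq> {..<M} \<and> length w \<le> L} \<subseteq> (\<lambda>f. \<Prod>i<M. r i ^ f i) ` ?P"
  proof clarify
    fix w assume w: "set w \<subseteq> {..<M}" "length w \<le> L"
    show "ratio w \<in> (\<lambda>f. \<Prod>i<M. r i ^ f i) ` ?P"
    proof (rule image_eqI)
      show "ratio w = (\<Prod>i<M. r i ^ restrict (count_list w) {..<M} i)"
        using ratio_eq_prod_count[OF w(1)] by simp
      show "restrict (count_list w) {..<M} \<in> ?P"
        using count_le_length[of w] w(2) by (auto intro: le_trans)
    qed
  qed
  have fin: "finite ?P" by (intro finite_PiE) auto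
  then show "finite (ratio ` {w. set w \<subseteq> {..<M} \<and> length w \<le> L})"
    using sub by (meson finite_imageI finite_subset)
  have "card (ratio ` {w. set w \<subseteq> {..<M} \<and> length w \<le> L}) \<le> card ((\<lambda>f. \<Prod>i<M. r i ^ f i) ` ?P)"
    using sub fin by (intro card_mono) auto
  also have "\<dots> \<le> card ?P" by (rule card_image_le[OF fin])
  also have "\<dots> = (L + 1) ^ M" by (simp add: card_PiE)
  finally show "card (ratio ` {w. set w \<subseteq> {..<M} \<and> length w \<le> L}) \<le> (L + 1) ^ M" .
qed

lemma return_word_semigroup:
  assumes j: "j < M"
  shows "orthogonal_semigroup (word_product T ` return_words M A j)"
proof
  fix P R
  assume P: "P \<in> word_product T ` return_words M A j"
  then show "orthogonal_matrix P" using orthogonal_word_product return_word_set[OF j] by blast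
  assume "R \<in> word_product T ` return_words M A j"
  with P show "P ** R \<in> word_product T ` return_words M A j"
    using return_word_append[OF j] by (auto simp: word_product_append[symmetric])
next
  show "word_product T ` return_words M A j \<noteq> {}"
    using connecting_word[OF j j] j by (auto simp: return_word_iff)
qed

lemma finite_correcting_words:
  assumes j: "j < M" and "Q \<in> orthogonal_closure (transformation_group M A T j)" "0 < \<epsilon>"
  shows "\<exists>W. finite W \<and> W \<subseteq> return_words M A j \<and>
    (\<forall>u\<in>return_words M A j. \<exists>w\<in>W. op_norm (word_product T (w @ u) - Q) < \<epsilon>)"
proof -
  interpret G: orthogonal_semigroup "word_product T ` return_words M A j"
    by (rule return_word_semigroup[OF j])
  obtain \<W> where W: "finite \<W>" "\<W> \<subseteq> word_product T ` return_words M A j"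
    "\<forall>B \<in> word_product T ` return_words M A j. \<exists>C\<in>\<W>. op_norm (C ** B - Q) < \<epsilon>"
    using G.finite_correction[OF assms(2)[unfolded transformation_group_def] assms(3)] by blast
  obtain W where W': "finite W" "W \<subseteq> return_words M A j" "\<W> = word_product T ` W"
    using finite_subset_image[OF W(1,2)] by blast
  then show ?thesis
    using W(3) by (intro exI[of _ W]) (auto simp: word_product_append)
qed

text \<open>At the scale \<open>exp (- x)\<close> there are more than \<open>exp (t * x)\<close> words with disjoint pieces, where
  \<open>\<tau> < t\<close>, but only polynomially many ratios in \<open>x\<close> and a number of correcting words that does not
  depend on \<open>x\<close>. The most frequent combination of both therefore occurs for at least \<open>\<rho> powr - \<tau>\<close> words.\<close>

lemma homogeneous_return_words:
  assumes j: "j < M" and Q: "Q \<in> orthogonal_closure (transformation_group M A T j)" and \<epsilon>: "0 < \<epsilon>"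
    and \<tau>: "0 \<le> \<tau>" "\<tau> < hausdorff_dim (subshift_set M A S)"
  shows "\<exists>U \<rho>. finite U \<and> U \<subseteq> return_words M A j \<and> 0 < \<rho> \<and> \<rho> < 1 \<and>
    (\<forall>w\<in>U. ratio w = \<rho> \<and> op_norm (word_product T w - Q) < \<epsilon>) \<and>
    disjoint_family_on (\<lambda>w. foldr S w ` F j) U \<and> 1 \<le> real (card U) * \<rho> powr \<tau>"
proof -
  obtain t where t: "\<tau> < t" "t < hausdorff_dim (subshift_set M A S)" using dense \<tau>(2) by blast
  obtain W where W: "finite W" "W \<subseteq> return_words M A j"
    "\<forall>u\<in>return_words M A j. \<exists>w\<in>W. op_norm (word_product T (w @ u) - Q) < \<epsilon>"
    using finite_correcting_words[OF j Q \<epsilon>] by blast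
  obtain \<kappa> where \<kappa>: "0 < \<kappa>" "\<forall>\<delta> x. 0 < \<delta> \<longrightarrow> \<delta> \<le> 1 \<longrightarrow> x \<in> F j \<longrightarrow>
    (\<exists>u\<in>return_words M A j. (\<forall>y\<in>F j. dist x (foldr S u y) \<le> 2 * radius * \<delta>) \<and> \<kappa> * \<delta> \<le> ratio u)"
    using local_return_words[OF j] by blast
  have "return_words M A j \<noteq> {}" using connecting_word[OF j j] j by (auto simp: return_word_iff)
  then have "W \<noteq> {}" using W(3) by blast
  define \<beta> where "\<beta> = Min (ratio ` W)"
  have \<beta>: "0 < \<beta>"
    unfolding \<beta>_def using W \<open>W \<noteq> {}\<close> return_word_ratio(1)[OF j] by (subst Min_gr_iff) auto
  have \<beta>_le: "\<beta> \<le> ratio w" if "w \<in> W" for w unfolding \<beta>_def using that W(1) by (intro Min_le) auto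
  \<comment> \<open>A word of length \<open>n\<close> and ratio at least \<open>\<kappa> * exp (- x)\<close> satisfies \<open>n \<le> l x\<close>.\<close>
  define l where "l x = (x - ln \<kappa>) / - ln r_max" for x
  define N where "N = real (card W)"
  \<comment> \<open>Pieces within \<open>2 * radius * \<delta>\<close> of two points more than \<open>5 * radius * \<delta>\<close> apart are disjoint.\<close>
  define c where "c = 5 * radius"
  have c: "0 < c" using radius_pos by (simp add: c_def)
  define a b d where "a = t - \<tau>" and "b = 1 / - ln r_max" and "d = 1 - ln \<kappa> / - ln r_max"
  have ab: "0 < a" "0 < b" using t r_max by (auto simp: a_def b_def)
  have l_eq: "l x + 1 = b * x + d" for x
    by (simp add: l_def b_def d_def diff_divide_distrib)
  have "((\<lambda>x. N * (b * x + d) ^ M * exp (- (a * x))) \<longlongrightarrow> 0) at_top"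
    using ab by real_asymp
  then have ev: "\<forall>\<^sub>F x in at_top. N * (b * x + d) ^ M * exp (- (a * x)) < (\<beta> * \<kappa>) powr \<tau>"
    by (rule order_tendstoD) (use \<beta> \<kappa> in auto)
  have "\<forall>\<^sub>F x in at_top. 0 \<le> x \<and> 0 \<le> l x \<and> N * (b * x + d) ^ M * exp (- (a * x)) < (\<beta> * \<kappa>) powr \<tau> \<and>
    (\<forall>P. finite P \<longrightarrow> F j \<subseteq> (\<Union>p\<in>P. cball p (c * exp (- x))) \<longrightarrow> exp (t * x) < real (card P))"
  proof (intro eventually_conj ev covering_number_F_ge)
    show "\<forall>\<^sub>F x in at_top. (0::real) \<le> x" by (rule eventually_ge_at_top)
    show "\<forall>\<^sub>F x in at_top. 0 \<le> l x"
      using eventually_ge_at_top[of "ln \<kappa>"]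
      by eventually_elim (unfold l_def, rule divide_nonneg_pos, use r_max in auto)
  qed (use j t \<tau> c in auto)
  then obtain x where x: "0 \<le> x" "0 \<le> l x" "N * (b * x + d) ^ M * exp (- (a * x)) < (\<beta> * \<kappa>) powr \<tau>"
    "\<And>P. finite P \<Longrightarrow> F j \<subseteq> (\<Union>p\<in>P. cball p (c * exp (- x))) \<Longrightarrow> exp (t * x) < real (card P)"
    using eventually_happens'[OF trivial_limit_at_top_linorder] by blast
  define \<delta> where "\<delta> = exp (- x)"
  have \<delta>: "0 < \<delta>" "\<delta> \<le> 1" using x by (auto simp: \<delta>_def)
  obtain P where P: "finite P" "P \<subseteq> F j" "\<And>p q. p \<in> P \<Longrightarrow> q \<in> P \<Longrightarrow> p \<noteq> q \<Longrightarrow> c * \<delta> < dist p q"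
    "F j \<subseteq> (\<Union>p\<in>P. cball p (c * \<delta>))"
    using maximal_separated_subset[OF compact_F mult_pos_pos[OF c \<delta>(1)], of j] by blast
  have card_P: "exp (t * x) < real (card P)" using x(4)[OF P(1)] P(4) by (simp add: \<delta>_def)
  have "\<forall>p\<in>P. \<exists>u. u \<in> return_words M A j \<and> (\<forall>y\<in>F j. dist p (foldr S u y) \<le> 2 * radius * \<delta>) \<and> \<kappa> * \<delta> \<le> ratio u"
    using \<kappa>(2) \<delta> P(2) by blast
  from bchoice[OF this] obtain u where
    u: "\<forall>p\<in>P. u p \<in> return_words M A j \<and> (\<forall>y\<in>F j. dist p (foldr S (u p) y) \<le> 2 * radius * \<delta>) \<and> \<kappa> * \<delta> \<le> ratio (u p)" ..
  have uR: "u p \<in> return_words M A j" if "p \<in> P" for p using u that by blast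
  have "\<forall>p\<in>P. \<exists>w. w \<in> W \<and> op_norm (word_product T (w @ u p) - Q) < \<epsilon>" using W(3) uR by blast
  from bchoice[OF this] obtain e where e: "\<forall>p\<in>P. e p \<in> W \<and> op_norm (word_product T (e p @ u p) - Q) < \<epsilon>" ..
  have disj: "foldr S (u p) y \<noteq> foldr S (u q) z"
    if "p \<in> P" "q \<in> P" "p \<noteq> q" "y \<in> F j" "z \<in> F j" for p q y z
  proof
    assume eq: "foldr S (u p) y = foldr S (u q) z"
    have "dist p q \<le> dist p (foldr S (u p) y) + dist q (foldr S (u q) z)"
      unfolding eq by (rule dist_triangle2)
    also have "\<dots> \<le> 2 * radius * \<delta> + 2 * radius * \<delta>"
      using u that by (intro add_mono) auto
    also have "\<dots> \<le> c * \<delta>"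
      using radius_pos \<delta> by (simp add: c_def)
    finally show False using P(3)[OF that(1-3)] by simp
  qed
  define L where "L = nat \<lfloor>l x\<rfloor>"
  define B where "B = W \<times> ratio ` {w. set w \<subseteq> {..<M} \<and> length w \<le> L}"
  have len: "length (u p) \<le> L" if "p \<in> P" for p
  proof -
    have "\<kappa> * \<delta> \<le> r_max ^ length (u p)"
      using u that ratio_bounds(2)[OF return_word_set[OF j uR[OF that]]] by fastforce
    then have "ln (\<kappa> * \<delta>) \<le> ln (r_max ^ length (u p))"
      using \<kappa>(1) \<delta>(1) r_max(1) by (subst ln_le_cancel_iff) auto
    then have "ln \<kappa> - x \<le> real (length (u p)) * ln r_max"
      using \<kappa>(1) \<delta>(1) r_max(1) by (simp add: ln_mult ln_realpow \<delta>_def)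
    then have "real (length (u p)) \<le> l x"
      using r_max by (simp add: l_def field_simps)
    then show ?thesis by (simp add: L_def le_nat_floor)
  qed
  have classes: "(\<lambda>p. (e p, ratio (u p))) \<in> P \<rightarrow> B"
  proof
    fix p assume "p \<in> P"
    then have "e p \<in> W" "u p \<in> {w. set w \<subseteq> {..<M} \<and> length w \<le> L}"
      using e len return_word_set[OF j uR] by auto
    then show "(e p, ratio (u p)) \<in> B" by (simp add: B_def)
  qed
  have finB: "finite B" using W(1) card_ratios_le(1) by (simp add: B_def)
  have neB: "B \<noteq> {}"
  proof -
    have "[] \<in> {w. set w \<subseteq> {..<M} \<and> length w \<le> L}" by simp
    then show ?thesis using \<open>W \<noteq> {}\<close> unfolding B_def by blast
  qed
  obtain y where y: "y \<in> B" "card P \<le> card ((\<lambda>p. (e p, ratio (u p))) -` {y} \<inter> P) * card B"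
    using pigeonhole_card[OF classes P(1) finB neB] by blast
  obtain w\<^sub>0 \<rho>\<^sub>0 where y_eq: "y = (w\<^sub>0, \<rho>\<^sub>0)" by (cases y)
  define P' where "P' = {p \<in> P. e p = w\<^sub>0 \<and> ratio (u p) = \<rho>\<^sub>0}"
  have "(\<lambda>p. (e p, ratio (u p))) -` {y} \<inter> P = P'" by (auto simp: P'_def y_eq)
  with y have card_le: "card P \<le> card P' * card B" by simp
  have w0: "w\<^sub>0 \<in> W" "w\<^sub>0 \<in> return_words M A j" using y(1) W(2) by (auto simp: B_def y_eq)
  define \<rho> where "\<rho> = ratio w\<^sub>0 * \<rho>\<^sub>0"
  define U where "U = (\<lambda>p. w\<^sub>0 @ u p) ` P'"
  obtain z where z: "z \<in> F j" using F_nonempty[OF j] by blast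
  have "inj_on (\<lambda>p. w\<^sub>0 @ u p) P'"
  proof (rule inj_onI, rule ccontr)
    fix p q assume "p \<in> P'" "q \<in> P'" "w\<^sub>0 @ u p = w\<^sub>0 @ u q" "p \<noteq> q"
    then show False using disj[of p q z z] z by (simp add: P'_def)
  qed
  then have card_U: "card U = card P'" unfolding U_def by (rule card_image)
  have "0 < card P" using card_P by (metis exp_gt_zero less_trans of_nat_0_less_iff)
  then have "P' \<noteq> {}" using card_le by auto
  then obtain p where p: "p \<in> P'" by blast
  have \<rho>_eq: "\<rho> = ratio (w\<^sub>0 @ u p)" using p by (simp add: \<rho>_def P'_def)
  have \<rho>: "0 < \<rho>" "\<rho> < 1"
    using return_word_ratio[OF j return_word_append[OF j w0(2) uR]] p by (auto simp: \<rho>_eq P'_def)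
  have "\<kappa> * \<delta> \<le> \<rho>\<^sub>0" using u p by (auto simp: P'_def)
  then have \<rho>_ge: "\<beta> * (\<kappa> * \<delta>) \<le> \<rho>"
    unfolding \<rho>_def using \<beta>_le[OF w0(1)] \<beta> \<kappa>(1) \<delta>(1) return_word_ratio[OF j w0(2)] by (intro mult_mono) auto
  have card_B: "real (card B) \<le> N * (b * x + d) ^ M"
  proof -
    have "card B \<le> card W * (L + 1) ^ M"
      using card_ratios_le(2)[of L] by (simp add: B_def card_cartesian_product)
    then have "real (card B) \<le> N * (real L + 1) ^ M"
      unfolding N_def by (metis of_nat_1 of_nat_add of_nat_le_iff of_nat_mult of_nat_power)
    also have "\<dots> \<le> N * (l x + 1) ^ M"
      using x(2) by (intro mult_left_mono power_mono) (auto simp: L_def N_def)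
    finally show ?thesis by (simp add: l_eq)
  qed
  have "1 \<le> real (card U) * \<rho> powr \<tau>"
  proof -
    have B_pos: "0 < real (card B)" using finB neB by (simp add: card_gt_0_iff)
    have "real (card B) * exp (- (a * x)) \<le> N * (b * x + d) ^ M * exp (- (a * x))"
      using card_B by (intro mult_right_mono) auto
    also have "\<dots> \<le> (\<beta> * \<kappa>) powr \<tau>" using x(3) by simp
    finally have "real (card B) \<le> (\<beta> * \<kappa>) powr \<tau> * exp (a * x)"
      by (simp add: exp_minus field_simps)
    also have "\<dots> = exp (t * x) * (\<beta> * (\<kappa> * \<delta>)) powr \<tau>"
    proof -
      have "a * x = t * x + - x * \<tau>" by (simp add: a_def algebra_simps)
      then have "exp (a * x) = exp (t * x) * \<delta> powr \<tau>"
        by (simp only: exp_add \<delta>_def exp_powr_real)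
      then show ?thesis by (simp add: powr_mult)
    qed
    also have "\<dots> \<le> real (card P) * \<rho> powr \<tau>"
      using card_P \<rho>_ge \<tau>(1) \<beta> \<kappa>(1) \<delta>(1) by (intro mult_mono powr_mono2) auto
    also have "\<dots> \<le> (real (card P') * real (card B)) * \<rho> powr \<tau>"
      using card_le by (intro mult_right_mono) (simp_all flip: of_nat_mult)
    finally have "real (card B) * 1 \<le> real (card B) * (real (card U) * \<rho> powr \<tau>)"
      by (simp add: card_U mult_ac)
    then show ?thesis using B_pos mult_le_cancel_left_pos by blast
  qed
  moreover have "finite U" using P(1) by (simp add: U_def P'_def)
  moreover have "U \<subseteq> return_words M A j"
    using return_word_append[OF j w0(2) uR] by (auto simp: U_def P'_def)
  moreover have "\<forall>w\<in>U. ratio w = \<rho> \<and> op_norm (word_product T w - Q) < \<epsilon>"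
    using e by (auto simp: U_def P'_def \<rho>_def)
  moreover have "disjoint_family_on (\<lambda>w. foldr S w ` F j) U"
  proof (unfold disjoint_family_on_def, intro ballI impI, rule ccontr)
    fix w w' assume ww: "w \<in> U" "w' \<in> U" "w \<noteq> w'" "foldr S w ` F j \<inter> foldr S w' ` F j \<noteq> {}"
    then obtain p q where pq: "p \<in> P'" "q \<in> P'" "w = w\<^sub>0 @ u p" "w' = w\<^sub>0 @ u q" by (auto simp: U_def)
    obtain y z where yz: "y \<in> F j" "z \<in> F j" "foldr S w y = foldr S w' z" using ww(4) by blast
    then have "ratio w\<^sub>0 * dist (foldr S (u p) y) (foldr S (u q) z) = 0"
      using pq by (simp flip: dist_word[OF return_word_set[OF j w0(2)]])
    then have "foldr S (u p) y = foldr S (u q) z" using return_word_ratio(1)[OF j w0(2)] by simp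
    moreover have "p \<noteq> q" using pq ww(3) by auto
    ultimately show False using disj[of p q y z] pq yz by (simp add: P'_def)
  qed
  ultimately show ?thesis using \<rho> by blast
qed

lemma single_return_word:
  assumes j: "j < M" and Q: "Q \<in> orthogonal_closure (transformation_group M A T j)" and \<epsilon>: "0 < \<epsilon>"
  shows "\<exists>w\<in>return_words M A j. op_norm (word_product T w - Q) < \<epsilon>"
proof -
  obtain u where "u \<in> return_words M A j" using connecting_word[OF j j] j by (auto simp: return_word_iff)
  then show ?thesis
    using finite_correcting_words[OF assms] return_word_append[OF j] by blast
qed

section \<open>Self-similar subsets\<close>

text \<open>The attractor lies in \<open>F j\<close>, hence inherits its strong separation from the images of \<open>F j\<close>.\<close>

lemma self_similar_subset_of_words:
  assumes j: "j < M" and U: "finite U" "U \<subseteq> return_words M A j"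
    and \<rho>: "0 < \<rho>" "\<rho> < 1" "\<And>w. w \<in> U \<Longrightarrow> ratio w = \<rho>"
    and disj: "disjoint_family_on (\<lambda>w. foldr S w ` F j) U"
    and \<tau>: "0 \<le> \<tau>" "1 \<le> real (card U) * \<rho> powr \<tau>"
  shows "\<exists>m h K. bij_betw h {1..m} U \<and>
    ss_ifs m (\<lambda>_. \<rho>) (\<lambda>i. word_product T (h i)) (\<lambda>i. foldr S (h i) 0) \<and>
    is_attractor m (\<lambda>i. similarity \<rho> (word_product T (h i)) (foldr S (h i) 0)) K \<and>
    strong_separation m (\<lambda>i. similarity \<rho> (word_product T (h i)) (foldr S (h i) 0)) K \<and>
    K \<subseteq> F j \<and> \<tau> \<le> hausdorff_dim K"
proof -
  obtain h where h: "bij_betw h {1..card U} U"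
    using ex_bij_betw_nat_finite_1[OF U(1)] by blast
  let ?J = "{1..card U}"
  define f where "f i = similarity \<rho> (word_product T (h i)) (foldr S (h i) 0)" for i
  have "U \<noteq> {}" using \<tau>(2) by auto
  then have m: "1 \<le> card U" using U(1) by (simp add: Suc_le_eq card_gt_0_iff)
  have hU: "h i \<in> U" if "i \<in> ?J" for i using bij_betw_apply[OF h that] .
  have f_eq: "f i = foldr S (h i)" if "i \<in> ?J" for i
  proof
    show "f i x = foldr S (h i) x" for x
      using word_similarity[of "h i" x, symmetric] \<rho>(3)[OF hU[OF that]] by (simp add: f_def)
  qed
  have orth: "orthogonal_matrix (word_product T (h i))" if "i \<in> ?J" for i
    using orthogonal_word_product return_word_set[OF j] hU[OF that] U(2) by blast
  have f_F: "f i ` F j \<subseteq> F j" if "i \<in> ?J" for i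
    unfolding f_eq[OF that] using return_word_F[OF j] hU[OF that] U(2) by blast
  have f_cont: "continuous_on UNIV (f i)" for i unfolding f_def by (rule continuous_similarity)
  obtain K where K: "K \<subseteq> F j" "K \<noteq> {}" "compact K" "K = (\<Union>i\<in>?J. f i ` K)"
    by (rule attractor_in_invariant_compact[OF compact_F F_nonempty[OF j], of ?J f]) (use m f_F f_cont in auto)
  have sep: "disjoint_family_on (\<lambda>i. f i ` K) ?J"
  proof (unfold disjoint_family_on_def, intro ballI impI)
    fix i i' assume i: "i \<in> ?J" "i' \<in> ?J" "i \<noteq> i'"
    then have "h i \<noteq> h i'" using inj_on_contraD[OF bij_betw_imp_inj_on[OF h] i(3,1,2)] by simp
    then have "foldr S (h i) ` F j \<inter> foldr S (h i') ` F j = {}"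
      using disjoint_family_onD[OF disj hU[OF i(1)] hU[OF i(2)]] by blast
    then show "f i ` K \<inter> f i' ` K = {}"
      unfolding f_eq[OF i(1)] f_eq[OF i(2)] using K(1) by blast
  qed
  have "\<tau> \<le> hausdorff_dim K"
  proof (rule self_similar_hausdorff_dim_ge[OF _ K(3,2,4) sep])
    show "dist (f i x) (f i y) = \<rho> * dist x y" if "i \<in> ?J" for i x y
      unfolding f_def using orth[OF that] \<rho>(1) by (intro dist_similarity) auto
  qed (use \<rho> \<tau> in auto)
  moreover have "ss_ifs (card U) (\<lambda>_. \<rho>) (\<lambda>i. word_product T (h i)) (\<lambda>i. foldr S (h i) 0)"
    using m \<rho> orth by (auto simp: ss_ifs_def contracting_similarities_def)
  moreover have "is_attractor (card U) f K" using K by (auto simp: is_attractor_def)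
  moreover have "strong_separation (card U) f K" using sep by (simp add: strong_separation_def)
  ultimately show ?thesis
    using h K(1) unfolding f_def by blast
qed

end

theorem theorem1p18:
  fixes M :: nat and A :: "nat mat"
    and r :: "nat \<Rightarrow> real" and T :: "nat \<Rightarrow> real^'d^'d" and v :: "nat \<Rightarrow> real^'d"
    and S :: "nat \<Rightarrow> real^'d \<Rightarrow> real^'d"
    and j :: nat and \<epsilon> :: real and Q :: "real^'d^'d"
  defines "S \<equiv> \<lambda>i. similarity (r i) (T i) (v i)"
  assumes "transition_matrix M A"
    and "irreducible_subshift M A"
    and "contracting_similarities {..<M} r T v"
    and "\<exists>i<M. \<exists>x\<in>subshift_cylinder_set M A S i. \<exists>y\<in>subshift_cylinder_set M A S i. x \<noteq> y"
    and "j < M"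
    and "0 < \<epsilon>"
    and "Q \<in> orthogonal_closure (transformation_group M A T j)"
  shows "\<exists>\<rho> m r' T' v' K.
           0 < \<rho> \<and> \<rho> < 1 \<and>
           ss_ifs m r' T' v' \<and>
           is_attractor m (\<lambda>i. similarity (r' i) (T' i) (v' i)) K \<and>
           strong_separation m (\<lambda>i. similarity (r' i) (T' i) (v' i)) K \<and>
           K \<subseteq> subshift_cylinder_set M A S j \<and>
           subshift_cylinder_set M A S j \<subseteq> subshift_set M A S \<and>
           hausdorff_dim (subshift_set M A S) - \<epsilon> < hausdorff_dim K \<and>
           (\<forall>i\<in>{1..m}. op_norm (T' i - Q) < \<epsilon> \<and> r' i = \<rho>)"
proof -
  interpret I: irreducible_similarity_system M A r T v
    using assms(2-4) by unfold_locales
  have S_eq: "S = I.S" by (simp add: S_def I.S_def fun_eq_iff)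
  define D where "D = hausdorff_dim (subshift_set M A S)"
  have words: "\<exists>\<tau> U \<rho>. 0 \<le> \<tau> \<and> D - \<epsilon> < \<tau> \<and> finite U \<and> U \<subseteq> return_words M A j \<and> 0 < \<rho> \<and> \<rho> < 1 \<and>
    (\<forall>w\<in>U. I.ratio w = \<rho> \<and> op_norm (word_product T w - Q) < \<epsilon>) \<and>
    disjoint_family_on (\<lambda>w. foldr I.S w ` I.F j) U \<and> 1 \<le> real (card U) * \<rho> powr \<tau>"
  proof (cases "D - \<epsilon> < 0")
    case True
    \<comment> \<open>Nonnegative dimension is all that is asked for, and a single similarity provides it.\<close>
    obtain w where w: "w \<in> return_words M A j" "op_norm (word_product T w - Q) < \<epsilon>"
      using I.single_return_word[OF \<open>j < M\<close> assms(8) \<open>0 < \<epsilon>\<close>] by blast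
    then show ?thesis
      using True I.return_word_ratio[OF \<open>j < M\<close> w(1)]
      by (intro exI[of _ 0] exI[of _ "{w}"] exI[of _ "I.ratio w"]) (auto simp: disjoint_family_on_def)
  next
    case False
    obtain \<tau> where "D - \<epsilon> < \<tau>" "\<tau> < D" using dense[of "D - \<epsilon>" D] \<open>0 < \<epsilon>\<close> by auto
    moreover from this have "0 \<le> \<tau>" using False by simp
    ultimately show ?thesis
      using I.homogeneous_return_words[OF \<open>j < M\<close> assms(8) \<open>0 < \<epsilon>\<close>, of \<tau>] unfolding D_def S_eq by blast
  qed
  then obtain \<tau> U \<rho> where U: "0 \<le> \<tau>" "D - \<epsilon> < \<tau>" "finite U" "U \<subseteq> return_words M A j" "0 < \<rho>" "\<rho> < 1"
    "\<And>w. w \<in> U \<Longrightarrow> I.ratio w = \<rho>" "\<And>w. w \<in> U \<Longrightarrow> op_norm (word_product T w - Q) < \<epsilon>"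
    "disjoint_family_on (\<lambda>w. foldr I.S w ` I.F j) U" "1 \<le> real (card U) * \<rho> powr \<tau>"
    by blast
  obtain m h K where K: "bij_betw h {1..m} U"
    "ss_ifs m (\<lambda>_. \<rho>) (\<lambda>i. word_product T (h i)) (\<lambda>i. foldr I.S (h i) 0)"
    "is_attractor m (\<lambda>i. similarity \<rho> (word_product T (h i)) (foldr I.S (h i) 0)) K"
    "strong_separation m (\<lambda>i. similarity \<rho> (word_product T (h i)) (foldr I.S (h i) 0)) K"
    "K \<subseteq> I.F j" "\<tau> \<le> hausdorff_dim K"
    using I.self_similar_subset_of_words[OF \<open>j < M\<close> U(3-7,9,1,10)] by blast
  have near: "op_norm (word_product T (h i) - Q) < \<epsilon>" if "i \<in> {1..m}" for i
    by (rule U(8)[OF bij_betw_apply[OF K(1) that]])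
  have "K \<subseteq> subshift_cylinder_set M A S j" using K(5) by (simp add: I.F_def S_eq)
  moreover have "subshift_cylinder_set M A S j \<subseteq> subshift_set M A S"
    by (auto simp: subshift_cylinder_set_def subshift_set_def)
  moreover have "hausdorff_dim (subshift_set M A S) - \<epsilon> < hausdorff_dim K"
    using U(2) K(6) by (simp add: D_def)
  ultimately show ?thesis
    using U(5,6) K(2-4) near by blast
qed

end
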